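(* Let $0\le\theta_C<1$ and $0\le\theta_H<1$ be real numbers. The following two assertions are equivalent. (i) For every $\varepsilon>0$, $\Delta_C(x)=O(x^{\theta_C+\varepsilon})$ and $\Delta_H(x)=O(x^{\theta_H+\varepsilon})$ for real $x\ge 1$. (ii) For every $\varepsilon>0$, $$\mathcal F(n)=\frac{\pi}{8}\,n+O(n^{\theta_C+\varepsilon})\quad (n\in\mathbb N \text{ odd}),\qquad \mathcal F(n)=\frac{3\log 2}{4}\,n+O(n^{\theta_H+\varepsilon})\quad (n\in\mathbb N\text{ even}).$$ In all of these bounds the implied constants may depend on $\varepsilon$ (and on $\theta_C,\theta_H$) but not on $x$ or $n$.
   Context: The Fibonacci sequence is $F_0=0$, $F_1=1$, $F_{j+2}=F_{j+1}+F_j$ for $j\ge 0$. $\{x\}=x-\lfloor x\rfloor$ is the fractional part and $\log$ is the natural logarithm. $\mathbb N=\{1,2,3,\dots\}$. For $n\in\mathbb N$, $$\mathcal F(n)=\sum_{k=1}^{n}\left\{\frac{F_n}{F_k}\right\}.$$ For real $x\ge 1$ let $N_H(x)=\#\{(a,b)\in\mathbb N^2: ab\le x\}$ and $N_C(x)=\#\{(a,b)\in\mathbb Z^2: a^2+b^2\le x\}$. With $\gamma$ Euler's constant, the error terms $\Delta_H$ and $\Delta_C$ are defined by $$N_H(x)=x\log x+(2\gamma-1)x+\Delta_H(x),\qquad N_C(x)=\pi x+\Delta_C(x).$$ *)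

theory Defs
  imports "HOL-Analysis.Analysis" "HOL-Number_Theory.Fib"
begin

definition fib_frac_sum :: "nat \<Rightarrow> real" where
  "fib_frac_sum n = (\<Sum>k=1..n. frac (real (fib n) / real (fib k)))"

definition N_H :: "real \<Rightarrow> nat" where
  "N_H x = card {(a :: nat, b :: nat). a \<ge> 1 \<and> b \<ge> 1 \<and> real (a * b) \<le> x}"

definition N_C :: "real \<Rightarrow> nat" where
  "N_C x = card {(a :: int, b :: int). real_of_int (a\<^sup>2 + b\<^sup>2) \<le> x}"

text \<open>The two sets counted above are finite, so \<^const>\<open>card\<close> is not degenerate.\<close>

lemma finite_hyperbola_points:
  "finite {(a :: nat, b :: nat). a \<ge> 1 \<and> b \<ge> 1 \<and> real (a * b) \<le> x}"
proof (rule finite_subset)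
  show "{(a :: nat, b :: nat). a \<ge> 1 \<and> b \<ge> 1 \<and> real (a * b) \<le> x}
          \<subseteq> {..nat \<lfloor>x\<rfloor>} \<times> {..nat \<lfloor>x\<rfloor>}"
  proof clarify
    fix a b :: nat
    assume ab: "a \<ge> 1" "b \<ge> 1" "real (a * b) \<le> x"
    then have "a * b \<le> nat \<lfloor>x\<rfloor>" by (intro le_nat_floor)
    moreover have "a \<le> a * b" "b \<le> a * b" using ab by simp_all
    ultimately show "a \<in> {..nat \<lfloor>x\<rfloor>} \<and> b \<in> {..nat \<lfloor>x\<rfloor>}"
      by (metis atMost_iff order_trans)
  qed
qed simp

lemma finite_circle_points:
  "finite {(a :: int, b :: int). real_of_int (a\<^sup>2 + b\<^sup>2) \<le> x}"
proof (rule finite_subset)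
  show "{(a :: int, b :: int). real_of_int (a\<^sup>2 + b\<^sup>2) \<le> x}
          \<subseteq> {-\<lfloor>x\<rfloor>..\<lfloor>x\<rfloor>} \<times> {-\<lfloor>x\<rfloor>..\<lfloor>x\<rfloor>}"
  proof clarify
    fix a b :: int
    assume "real_of_int (a\<^sup>2 + b\<^sup>2) \<le> x"
    then have le: "a\<^sup>2 + b\<^sup>2 \<le> \<lfloor>x\<rfloor>" by (simp add: le_floor_iff)
    have abs_le: "\<bar>c\<bar> \<le> c\<^sup>2" for c :: int
      using self_le_power[of "\<bar>c\<bar>" 2] by (cases "c = 0") auto
    have "\<bar>a\<bar> \<le> \<lfloor>x\<rfloor>" "\<bar>b\<bar> \<le> \<lfloor>x\<rfloor>"
      using le abs_le[of a] abs_le[of b] zero_le_power2[of a] zero_le_power2[of b]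
      by linarith+
    then show "a \<in> {-\<lfloor>x\<rfloor>..\<lfloor>x\<rfloor>} \<and> b \<in> {-\<lfloor>x\<rfloor>..\<lfloor>x\<rfloor>}" by auto
  qed
qed simp

definition Delta_H :: "real \<Rightarrow> real" where
  "Delta_H x = real (N_H x) - (x * ln x + (2 * euler_mascheroni - 1) * x)"

definition Delta_C :: "real \<Rightarrow> real" where
  "Delta_C x = real (N_C x) - pi * x"

end

theory Submission
  imports Defs "HOL-Number_Theory.Cong" "HOL-Real_Asymp.Real_Asymp"
begin

text \<open>
  Write \<open>F\<close> for the Fibonacci sequence, \<open>n = q k + r\<close> for division with remainder and \<open>\<chi>\<close> for the
  nontrivial character modulo 4. Modulo \<open>F k\<close> one has \<open>F n \<equiv> \<plusminus> F t\<close>, where \<open>t\<close> is \<open>r\<close> for even \<open>q\<close> and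
  \<open>k - r\<close> for odd \<open>q\<close> (\<open>fib_mod_fib\<close>). Since \<open>F t / F k\<close> is exponentially small in \<open>k - t\<close>, the fractional
  part of \<open>F n / F k\<close> is close to 0 or 1 according to the sign, unless \<open>k\<close> divides a number very near
  to \<open>n\<close>. The divisor bound makes the total error \<open>O(n powr \<epsilon>)\<close>, so the sum of fractional parts may be
  replaced by the number of \<open>k \<le> n\<close> with a negative sign (\<open>fib_frac_sum_minus_neg_count\<close>).

  The sign depends only on \<open>k\<close> modulo 2 and \<open>q\<close> modulo 4, which makes this number a lattice point
  count. For odd \<open>n\<close> it is the number of odd \<open>k\<close> with \<open>q\<close> congruent to 1 or 2 modulo 4, the sum of \<open>\<chi> m\<close>
  over all \<open>k m \<le> n\<close> with \<open>k\<close> odd. By Jacobi's two-square theorem it equals \<open>(N_C n - N_C (n / 2)) / 4\<close>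
  (\<open>neg_count_odd\<close>, \<open>N_C_eq_floor_sum\<close>). For \<open>n = 2 y\<close> it equals
  \<open>2 N_H y - 5 N_H (y / 2) + 2 N_H (y / 4)\<close> (\<open>neg_count_even\<close>). Inserting the main terms yields
  \<open>\<pi> n / 8\<close> and \<open>(3 ln 2 / 4) n\<close>, and bounds for the lattice point errors transfer at once.

  For the converse, the two combinations are step functions that are controlled at all real arguments
  by their values at odd, respectively even, \<open>n\<close>. The combination \<open>D x - D (x / 2)\<close> is inverted by a
  geometric series (\<open>bound_from_halving_difference\<close>). The other one corresponds to the polynomial
  \<open>2 - 5 S + 2 S\<^sup>2 = (2 - S) (1 - 2 S)\<close> in the shift \<open>x \<mapsto> x / 2\<close>. Inverting \<open>1 - 2 S\<close> determines \<open>D\<close> only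
  up to a function of exact order \<open>x\<close>, which is excluded by Dirichlet's \<open>D x = o(x)\<close> together with an
  exponent below 1 (\<open>bound_from_second_order_recurrence\<close>, \<open>Delta_H_over_x_tendsto_0\<close>).

  The two-square theorem is obtained by elementary means: both the number of representations and four
  times the divisor sum, taken to be 1 at 0, satisfy \<open>(\<Sum>i. (n - 3 i\<^sup>2) f (n - i\<^sup>2)) = 0\<close>, the former by symmetry of
  \<open>a\<^sup>2 + b\<^sup>2 + c\<^sup>2\<close>, the latter by Liouville's rearrangements of the form \<open>i\<^sup>2 + d e\<close>.
\<close>

section \<open>Jacobi's two-square theorem\<close>

definition chi4 :: "int \<Rightarrow> int" where
  "chi4 e = (if e mod 4 = 1 then 1 else if e mod 4 = 3 then -1 else 0)"

lemma chi4_minus: "chi4 (- e) = - chi4 e"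
proof -
  have "(-e) mod 4 = 1 \<longleftrightarrow> e mod 4 = 3" "(-e) mod 4 = 3 \<longleftrightarrow> e mod 4 = 1" by presburger+
  thus ?thesis by (simp add: chi4_def)
qed

lemma chi4_shift2: "chi4 (e + 2 * j) = (if even j then chi4 e else - chi4 e)"
proof -
  have "even j \<Longrightarrow> (e + 2 * j) mod 4 = e mod 4" by presburger
  moreover have "odd j \<Longrightarrow> (e + 2 * j) mod 4 = (e + 2) mod 4" by presburger
  moreover have "(e + 2) mod 4 = 1 \<longleftrightarrow> e mod 4 = 3" "(e + 2) mod 4 = 3 \<longleftrightarrow> e mod 4 = 1" by presburger+
  ultimately show ?thesis by (simp add: chi4_def)
qed

text \<open>
  The index set of a Liouville-type identity: sums over it are rearranged by the
  linear changes of variables that preserve the ternary form \<open>i\<^sup>2 + d e\<close>.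
\<close>

definition Liouville_set :: "int \<Rightarrow> (int \<times> int \<times> int) set" where
  "Liouville_set n = {(i, d, e). d > 0 \<and> e > 0 \<and> i\<^sup>2 + d * e = n}"

lemma abs_le_square_int: "\<bar>i::int\<bar> \<le> i\<^sup>2"
  using self_le_power[of "\<bar>i\<bar>" 2] by (cases "i = 0") auto

lemma pos_factors_le:
  fixes d e :: int assumes "d > 0" "e > 0" shows "d \<le> d * e" "e \<le> d * e"
  using assms by (simp_all add: mult_le_cancel_left1 mult_le_cancel_right1)

lemma Liouville_set_subset: "Liouville_set n \<subseteq> {-n..n} \<times> {1..n} \<times> {1..n}"
proof clarify
  fix i d e assume "(i, d, e) \<in> Liouville_set n"
  hence h: "d > 0" "e > 0" "i\<^sup>2 + d * e = n" by (auto simp: Liouville_set_def)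
  thus "i \<in> {-n..n} \<and> (d, e) \<in> {1..n} \<times> {1..n}"
    using abs_le_square_int[of i] pos_factors_le[OF h(1,2)] zero_le_power2[of i] mult_pos_pos[OF h(1,2)]
    unfolding atLeastAtMost_iff mem_Sigma_iff by (intro conjI; linarith)
qed

lemma finite_Liouville_set: "finite (Liouville_set n)"
  by (rule finite_subset[OF Liouville_set_subset]) auto

lemma sum_eq_0_by_involution:
  fixes f :: "'a \<Rightarrow> int"
  assumes "\<And>x. x \<in> A \<Longrightarrow> g x \<in> A" "\<And>x. x \<in> A \<Longrightarrow> g (g x) = x" 
    and "\<And>x. x \<in> A \<Longrightarrow> f (g x) = - f x"
  shows "sum f A = 0"
proof -
  have "sum f A = sum (\<lambda>x. - f x) A"
    by (rule sum.reindex_bij_witness[of _ g g]) (use assms in auto)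
  thus ?thesis by (simp add: sum_negf)
qed

text \<open>
  In the coordinates \<open>x = e - 2 i\<close>, \<open>y = d + i\<close>, \<open>z = 2 d + 2 i - e\<close> the form \<open>i\<^sup>2 + d e\<close> becomes
  \<open>y\<^sup>2 + (x\<^sup>2 - z\<^sup>2) / 4\<close> and the summand becomes \<open>\<chi>(2 y - z) x y\<close>, where \<open>\<chi>\<close> is the character
  modulo 4. It is odd in \<open>x\<close>, so the terms paired by \<open>x \<mapsto> - x\<close> cancel. This map keeps \<open>e\<close> and sends
  \<open>d\<close> to \<open>d + 2 i - e\<close>, so it is available exactly where \<open>d + 2 i - e\<close> is positive.
\<close>

lemma sum_Liouville_upper:
  "(\<Sum>(i, d, e) \<in> {(i, d, e) \<in> Liouville_set n. e < d + 2 * i}. chi4 e * ((e - 2 * i) * (d + i))) = 0"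
  by (rule sum_eq_0_by_involution[where g = "\<lambda>(i, d, e). (e - i, d + 2 * i - e, e)"])
     (auto simp: Liouville_set_def algebra_simps power2_eq_square)

lemma sum_chi4_symmetric:
  "(\<Sum>(y, d, e) \<in> Liouville_set n. chi4 (2 * y - d + e) * ((d + e) * y)) = 0"
proof (rule sum_eq_0_by_involution[where g = "\<lambda>(y, d, e). (-y, d, e)"])
  fix x assume "x \<in> Liouville_set n"
  obtain y d e where x: "x = (y, d, e)" by (cases x)
  have "chi4 (- (2 * y) - d + e) = chi4 (2 * y - d + e)"
    using chi4_shift2[of "2 * y - d + e" "-2*y"] by (simp add: algebra_simps)
  thus "(case case x of (y, d, e) \<Rightarrow> (-y, d, e) of
           (y, d, e) \<Rightarrow> chi4 (2 * y - d + e) * ((d + e) * y)) =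
         - (case x of (y, d, e) \<Rightarrow> chi4 (2 * y - d + e) * ((d + e) * y))"
    by (simp add: x)
qed (auto simp: Liouville_set_def)

text \<open>
  In the coordinates above, \<open>d + 2 i < e\<close> means \<open>z < x\<close>, so that
  both \<open>d = (x + z) / 2\<close> and \<open>d' = (x - z) / 2\<close> are positive and
  \<open>n = y\<^sup>2 + d d'\<close>. So the sum becomes one over the half \<open>2 y > d - d'\<close> of the same index set. The half
  \<open>2 y < d - d'\<close> contributes equally, by \<open>(y, d, d') \<mapsto> (- y, d', d)\<close>, and the whole sum vanishes
  because its summand is odd in \<open>y\<close>.
\<close>

lemma sum_Liouville_lower:
  "(\<Sum>(i, d, e) \<in> {(i, d, e) \<in> Liouville_set n. d + 2 * i < e}. chi4 e * ((e - 2 * i) * (d + i))) = 0"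
proof -
  define g where "g = (\<lambda>(y, d, e). chi4 (2 * y - d + e) * ((d + e) * y))"
  define P where "P = {(y, d, e) \<in> Liouville_set n. d - e < 2 * y}"
  define Q where "Q = {(y, d, e) \<in> Liouville_set n. 2 * y < d - e}"
  define Z where "Z = {(y, d, e) \<in> Liouville_set n. 2 * y = d - e}"
  have split: "Liouville_set n = P \<union> Q \<union> Z" by (auto simp: P_def Q_def Z_def)
  have fin: "finite P" "finite Q" "finite Z" 
    using finite_Liouville_set[of n] unfolding split by auto
  have "sum g (Liouville_set n) = sum g P + sum g Q + sum g Z"
    unfolding split
    by (subst sum.union_disjoint sum.union_disjoint; use fin in \<open>auto simp: P_def Q_def Z_def\<close>)+
  moreover have "sum g Z = 0"
    by (rule sum.neutral) (auto simp: Z_def g_def chi4_def)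
  moreover have "sum g Q = sum g P"
  proof (rule sum.reindex_bij_witness[of _ "\<lambda>(y, d, e). (-y, e, d)" "\<lambda>(y, d, e). (-y, e, d)"])
    fix x assume "x \<in> Q"
    obtain y d e where x: "x = (y, d, e)" by (cases x)
    show "g (case x of (y, d, e) \<Rightarrow> (-y, e, d)) = g x"
      using chi4_minus[of "2 * y - d + e"] by (simp add: x g_def algebra_simps)
  qed (auto simp: P_def Q_def Liouville_set_def algebra_simps)
  ultimately have "2 * sum g P = 0" using sum_chi4_symmetric[of n] unfolding g_def by simp
  moreover have "(\<Sum>(i, d, e) \<in> {(i, d, e) \<in> Liouville_set n. d + 2 * i < e}. chi4 e * ((e - 2 * i) * (d + i)))
      = sum g P"
    by (rule sum.reindex_bij_witness[of _ "\<lambda>(y, d, e). (y - d, d, 2 * y - d + e)" 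
                                         "\<lambda>(i, d, e). (d + i, d, e - 2 * i - d)"])
       (auto simp: P_def g_def Liouville_set_def algebra_simps power2_eq_square)
  ultimately show ?thesis by simp
qed

lemma sum_chi4_double: "(\<Sum>e=1..int (2 * s). chi4 e) = int (s mod 2)"
proof (induction s)
  case (Suc s)
  have "{1..int (2 * Suc s)} = insert (2 * int s + 2) (insert (2 * int s + 1) {1..int (2 * s)})" by auto
  hence "(\<Sum>e=1..int (2 * Suc s). chi4 e) = chi4 (2 * int s + 2) + (chi4 (2 * int s + 1) + int (s mod 2))"
    using Suc by (simp del: of_nat_mult of_nat_Suc)
  also have "\<dots> = int (Suc s mod 2)" 
    unfolding chi4_def by (cases "even s") (auto elim!: evenE oddE simp: mod_Suc)
  finally show ?case .
qed simp

text \<open>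
  This evaluates the boundary terms below. Raising \<open>s\<close> by 1 adds twice the partial sum up to
  \<open>2 s\<close> and \<open>\<chi>(2 s + 1)\<close>, which together are always 1.
\<close>

lemma sum_chi4_weighted: "(\<Sum>e=1..2 * int s. chi4 e * (2 * int s - e)) = int s"
proof (induction s)
  case (Suc s)
  have "{1..2 * int (Suc s)} = insert (2 * int s + 2) (insert (2 * int s + 1) {1..2 * int s})" by auto
  hence "(\<Sum>e=1..2 * int (Suc s). chi4 e * (2 * int (Suc s) - e)) = 
     chi4 (2 * int s + 1) + (\<Sum>e=1..2 * int s. chi4 e * (2 * int s - e) + 2 * chi4 e)"
    by (simp add: algebra_simps)
  also have "\<dots> = chi4 (2 * int s + 1) + int s + 2 * int (s mod 2)"
    using sum_chi4_double[of s] by (simp add: sum.distrib Suc sum_distrib_left [symmetric])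
  also have "\<dots> = int (Suc s)"
    unfolding chi4_def by (cases "even s") (auto elim!: evenE oddE)
  finally show ?case .
qed simp

text \<open>
  On the boundary \<open>d + 2 i = e\<close> the form is the square \<open>(d + i)\<^sup>2\<close>, so only perfect
  squares \<open>n\<close> have boundary terms, and these are parametrised by \<open>e\<close> alone.
\<close>

lemma sum_Liouville_middle_square:
  assumes "s > 0"
  shows "(\<Sum>(i, d, e) \<in> {(i, d, e) \<in> Liouville_set ((int s)\<^sup>2). d + 2 * i = e}. 
            chi4 e * ((e - 2 * i) * (d + i))) = (int s)\<^sup>2"
proof -
  have root: "d + i = int s" if "d > 0" "e > 0" "i\<^sup>2 + d * e = (int s)\<^sup>2" "d + 2 * i = e" for i d e
  proof -
    have "(d + i)\<^sup>2 = (int s)\<^sup>2" using that(3) unfolding that(4)[symmetric]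
      by (simp add: algebra_simps power2_eq_square)
    moreover have "d + i > 0" using that by linarith
    ultimately show ?thesis using assms by (simp add: power2_eq_iff_nonneg)
  qed
  have "(\<Sum>(i, d, e) \<in> {(i, d, e) \<in> Liouville_set ((int s)\<^sup>2). d + 2 * i = e}. 
            chi4 e * ((e - 2 * i) * (d + i))) = (\<Sum>e \<in> {1..<2 * int s}. chi4 e * (2 * int s - e) * int s)"
  proof (rule sum.reindex_bij_witness[of _ "\<lambda>e. (e - int s, 2 * int s - e, e)" "\<lambda>(i, d, e). e"])
    fix x assume "x \<in> {(i, d, e) \<in> Liouville_set ((int s)\<^sup>2). d + 2 * i = e}"
    then obtain i d e where x: "x = (i, d, e)" and h: "d > 0" "e > 0" "i\<^sup>2 + d * e = (int s)\<^sup>2" "d + 2 * i = e"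
      by (auto simp: Liouville_set_def)
    have i: "i = e - int s" "d = 2 * int s - e" using root[OF h] h(4) by auto
    show "(case case x of (i, d, e) \<Rightarrow> e of e \<Rightarrow> (e - int s, 2 * int s - e, e)) = x"
      by (simp add: x i)
    show "(case x of (i, d, e) \<Rightarrow> e) \<in> {1..<2 * int s}" using h i by (simp add: x)
    show "chi4 (case x of (i, d, e) \<Rightarrow> e) * (2 * int s - (case x of (i, d, e) \<Rightarrow> e)) * int s =
         (case x of (i, d, e) \<Rightarrow> chi4 e * ((e - 2 * i) * (d + i)))"
      by (simp add: x i)
  qed (auto simp: Liouville_set_def algebra_simps power2_eq_square)
  also have "\<dots> = (\<Sum>e \<in> {1..2 * int s}. chi4 e * (2 * int s - e)) * int s"
    unfolding sum_distrib_right by (rule sum.mono_neutral_left) auto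
  finally show ?thesis by (simp add: sum_chi4_weighted power2_eq_square)
qed

text \<open>
  Expanding \<open>(e - 2 i) (d + i)\<close> and discarding the terms that are odd in \<open>i\<close> leaves
  \<open>d e - 2 i\<^sup>2 = n - 3 i\<^sup>2\<close>, the weight that occurs in the recurrence for the number of
  representations as a sum of two squares.
\<close>

lemma sum_Liouville:
  assumes "n > 0"
  shows "(\<Sum>(i, d, e) \<in> Liouville_set n. chi4 e * (n - 3 * i\<^sup>2)) = 
           (if \<exists>s. n = s\<^sup>2 then n else 0)"
proof -
  define f where "f = (\<lambda>(i, d, e). chi4 e * ((e - 2 * i) * (d + i)))"
  define P where "P = {(i, d, e) \<in> Liouville_set n. e < d + 2 * i}"
  define Q where "Q = {(i, d, e) \<in> Liouville_set n. d + 2 * i < e}"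
  define Z where "Z = {(i, d, e) \<in> Liouville_set n. d + 2 * i = e}"
  have split: "Liouville_set n = P \<union> Q \<union> Z" by (auto simp: P_def Q_def Z_def)
  have fin: "finite P" "finite Q" "finite Z" 
    using finite_Liouville_set[of n] unfolding split by auto
  have "sum f (Liouville_set n) = sum f P + sum f Q + sum f Z"
    unfolding split
    by (subst sum.union_disjoint sum.union_disjoint; use fin in \<open>auto simp: P_def Q_def Z_def\<close>)+
  moreover have "sum f P = 0" "sum f Q = 0"
    unfolding f_def P_def Q_def by (fact sum_Liouville_upper sum_Liouville_lower)+
  moreover have "sum f Z = (if \<exists>s. n = s\<^sup>2 then n else 0)"
  proof (cases "\<exists>s. n = s\<^sup>2")
    case True
    then obtain s where s: "n = s\<^sup>2" by auto
    hence "n = (int (nat \<bar>s\<bar>))\<^sup>2" "nat \<bar>s\<bar> > 0" using assms by auto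
    thus ?thesis using sum_Liouville_middle_square[of "nat \<bar>s\<bar>"] True by (simp add: f_def Z_def)
  next
    case False
    have "(d + i)\<^sup>2 = n" if "(i, d, e) \<in> Z" for i d e
      using that by (auto simp: Z_def Liouville_set_def power2_eq_square algebra_simps)
    hence "Z = {}" using False by fast
    thus ?thesis using False by simp
  qed
  moreover have "(\<Sum>(i, d, e) \<in> Liouville_set n. chi4 e * (i * e - 2 * i * d)) = 0"
    by (rule sum_eq_0_by_involution[where g = "\<lambda>(i, d, e). (-i, d, e)"])
       (auto simp: Liouville_set_def algebra_simps)
  moreover have "sum f (Liouville_set n) = (\<Sum>(i, d, e) \<in> Liouville_set n. chi4 e * (n - 3 * i\<^sup>2))
     + (\<Sum>(i, d, e) \<in> Liouville_set n. chi4 e * (i * e - 2 * i * d))"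
    unfolding sum.distrib [symmetric] f_def
    by (rule sum.cong) (auto simp: Liouville_set_def algebra_simps power2_eq_square)
  ultimately show ?thesis by simp
qed

definition two_square_reps :: "int \<Rightarrow> (int \<times> int) set" where
  "two_square_reps n = {(a, b). a\<^sup>2 + b\<^sup>2 = n}"

lemma two_square_reps_subset: "two_square_reps n \<subseteq> {-n..n} \<times> {-n..n}"
proof clarify
  fix a b assume "(a, b) \<in> two_square_reps n"
  hence "a\<^sup>2 + b\<^sup>2 = n" by (auto simp: two_square_reps_def)
  thus "a \<in> {-n..n} \<and> b \<in> {-n..n}"
    using abs_le_square_int[of a] abs_le_square_int[of b] by (auto simp: abs_le_iff)
qed

lemma finite_two_square_reps: "finite (two_square_reps n)"
  by (rule finite_subset[OF two_square_reps_subset]) auto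

text \<open>
  The sum runs over the solutions of \<open>a\<^sup>2 + b\<^sup>2 + c\<^sup>2 = n\<close> with weight
  \<open>n - 3 a\<^sup>2 = (b\<^sup>2 - a\<^sup>2) + (c\<^sup>2 - a\<^sup>2)\<close>, and the three coordinates are interchangeable.
\<close>

lemma card_two_square_reps_recurrence:
  "(\<Sum>i=-n..n. (n - 3 * i\<^sup>2) * int (card (two_square_reps (n - i\<^sup>2)))) = 0"
proof -
  define T where "T = (SIGMA i:{-n..n}. two_square_reps (n - i\<^sup>2))"
  have mem: "x \<in> T \<longleftrightarrow> (case x of (a, b, c) \<Rightarrow> a\<^sup>2 + b\<^sup>2 + c\<^sup>2 = n)" for x
  proof -
    obtain a b c where x: "x = (a, b, c)" by (cases x)
    have "a\<^sup>2 + b\<^sup>2 + c\<^sup>2 = n \<Longrightarrow> a \<in> {-n..n}"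
      using abs_le_square_int[of a] zero_le_power2[of b] zero_le_power2[of c] 
      unfolding atLeastAtMost_iff by (intro conjI; linarith)
    thus ?thesis by (auto simp: T_def two_square_reps_def x)
  qed
  have "(\<Sum>(a, b, c) \<in> T. b\<^sup>2) = (\<Sum>(a, b, c) \<in> T. a\<^sup>2)"
    by (rule sum.reindex_bij_witness[of _ "\<lambda>(a, b, c). (b, a, c)" "\<lambda>(a, b, c). (b, a, c)"])
       (auto simp: mem)
  moreover have "(\<Sum>(a, b, c) \<in> T. c\<^sup>2) = (\<Sum>(a, b, c) \<in> T. a\<^sup>2)"
    by (rule sum.reindex_bij_witness[of _ "\<lambda>(a, b, c). (c, b, a)" "\<lambda>(a, b, c). (c, b, a)"])
       (auto simp: mem)
  moreover have "(\<Sum>(a, b, c) \<in> T. n - 3 * a\<^sup>2) = 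
     (\<Sum>(a, b, c) \<in> T. b\<^sup>2) + (\<Sum>(a, b, c) \<in> T. c\<^sup>2) - 2 * (\<Sum>(a, b, c) \<in> T. a\<^sup>2)"
    unfolding sum.distrib [symmetric] sum_distrib_left sum_subtractf [symmetric]
    by (rule sum.cong) (auto simp: mem)
  ultimately have "(\<Sum>(a, b, c) \<in> T. n - 3 * a\<^sup>2) = 0" by simp
  also have "(\<Sum>(a, b, c) \<in> T. n - 3 * a\<^sup>2) = (\<Sum>a=-n..n. \<Sum>x\<in>two_square_reps (n - a\<^sup>2). n - 3 * a\<^sup>2)"
    unfolding T_def by (subst sum.Sigma) (auto simp: finite_two_square_reps intro!: sum.cong)
  finally show ?thesis by (simp add: mult.commute)
qed

definition factor_pairs :: "int \<Rightarrow> (int \<times> int) set" where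
  "factor_pairs n = {(d, e). d > 0 \<and> e > 0 \<and> d * e = n}"

lemma finite_factor_pairs: "finite (factor_pairs n)"
  by (rule finite_subset[of _ "{1..n} \<times> {1..n}"])
     (auto simp: factor_pairs_def pos_factors_le)

lemma factor_pairs_empty: "n \<le> 0 \<Longrightarrow> factor_pairs n = {}"
  using mult_pos_pos by (fastforce simp: factor_pairs_def)

lemma sum_chi4_recurrence:
  assumes "n > 0"
  shows "(\<Sum>i=-n..n. (n - 3 * i\<^sup>2) * (\<Sum>(d, e)\<in>factor_pairs (n - i\<^sup>2). chi4 e)) = 
           (if \<exists>s. n = s\<^sup>2 then n else 0)"
proof -
  have "Liouville_set n = (SIGMA i:{-n..n}. factor_pairs (n - i\<^sup>2))"
    using Liouville_set_subset[of n] by (auto simp: Liouville_set_def factor_pairs_def) 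
  hence "(\<Sum>(i, d, e) \<in> Liouville_set n. chi4 e * (n - 3 * i\<^sup>2)) = 
     (\<Sum>i=-n..n. \<Sum>(d, e)\<in>factor_pairs (n - i\<^sup>2). chi4 e * (n - 3 * i\<^sup>2))"
    by (subst sum.Sigma) (auto simp: finite_factor_pairs intro!: sum.cong)
  also have "\<dots> = (\<Sum>i=-n..n. (n - 3 * i\<^sup>2) * (\<Sum>(d, e)\<in>factor_pairs (n - i\<^sup>2). chi4 e))"
    by (simp add: sum_distrib_left case_prod_unfold mult.commute)
  finally show ?thesis using sum_Liouville[OF assms] by simp
qed

text \<open>
  Both sides, extended by the value 1 at \<open>n = 0\<close>, satisfy the recurrence
  \<open>(\<Sum>i. (n - 3 i\<^sup>2) f (n - i\<^sup>2)) = 0\<close>. Its term for \<open>i = 0\<close> is \<open>n f n\<close>, so the recurrence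
  determines \<open>f n\<close> from smaller arguments.
\<close>

theorem Jacobi_two_squares:
  assumes "n > 0"
  shows "int (card (two_square_reps n)) = 4 * (\<Sum>(d, e)\<in>factor_pairs n. chi4 e)"
proof -
  define R where "R = (\<lambda>m. int (card (two_square_reps m)))"
  define E where "E = (\<lambda>m. 4 * (\<Sum>(d, e)\<in>factor_pairs m. chi4 e) + (if m = 0 then 1 else 0))"
  have E_rec: "(\<Sum>i=-n..n. (n - 3 * i\<^sup>2) * E (n - i\<^sup>2)) = 0" if "n > 0" for n
  proof -
    have "(\<Sum>i=-n..n. (n - 3 * i\<^sup>2) * (if n - i\<^sup>2 = 0 then 1 else 0)) = 
             (\<Sum>i \<in> {i\<in>{-n..n}. n = i\<^sup>2}. n - 3 * i\<^sup>2)"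
      by (subst sum.inter_filter) (auto intro!: sum.cong)
    also have "\<dots> = (if \<exists>s. n = s\<^sup>2 then - 4 * n else 0)"
    proof (cases "\<exists>s. n = s\<^sup>2")
      case True
      then obtain s where s: "n = s\<^sup>2" by auto
      have "{i\<in>{-n..n}. n = i\<^sup>2} = {s, -s}"
        using abs_le_square_int[of s] by (auto simp: s power2_eq_iff abs_le_iff)
      moreover have "s \<noteq> -s" using \<open>n > 0\<close> s by auto
      ultimately have "(\<Sum>i \<in> {i\<in>{-n..n}. n = i\<^sup>2}. n - 3 * i\<^sup>2) = 2 * (n - 3 * n)"
        using s by simp
      thus ?thesis using True by simp
    qed auto
    finally show ?thesis using sum_chi4_recurrence[OF that]
      by (simp add: E_def distrib_left sum.distrib mult.left_commute[of _ 4] 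
           sum_distrib_left[symmetric] split: if_splits)
  qed
  have "R m = E m" if "m \<ge> 0" for m
    using that
  proof (induction "nat m" arbitrary: m rule: less_induct)
    case less
    show ?case
    proof (cases "m = 0")
      case True
      have "two_square_reps 0 = {(0, 0)}" 
        by (auto simp: two_square_reps_def sum_power2_eq_zero_iff)
      thus ?thesis by (simp add: True R_def E_def factor_pairs_empty)
    next
      case False
      hence m: "m > 0" using less by simp
      have neg: "R k = E k" if "k < 0" for k
      proof -
        have "two_square_reps k = {}" 
          using that by (auto simp: two_square_reps_def not_sum_power2_lt_zero)
        thus ?thesis using that by (simp add: R_def E_def factor_pairs_empty)
      qed
      have other: "R (m - i\<^sup>2) = E (m - i\<^sup>2)" if "i \<noteq> 0" for i
      proof (cases "m - i\<^sup>2 < 0")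
        case False
        thus ?thesis using that m by (intro less) auto
      qed (use neg in auto)
      have "(\<Sum>i=-m..m. (m - 3 * i\<^sup>2) * (R (m - i\<^sup>2) - E (m - i\<^sup>2))) = 0"
        using E_rec[OF m] card_two_square_reps_recurrence[of m] 
        by (simp add: R_def right_diff_distrib sum_subtractf)
      also have "(\<Sum>i=-m..m. (m - 3 * i\<^sup>2) * (R (m - i\<^sup>2) - E (m - i\<^sup>2))) = 
                 (\<Sum>i\<in>{0}. (m - 3 * i\<^sup>2) * (R (m - i\<^sup>2) - E (m - i\<^sup>2)))"
        using m other by (intro sum.mono_neutral_right) auto
      finally show ?thesis using m by simp
    qed
  qed
  from this[of n] assms show ?thesis by (simp add: R_def E_def)
qed

section \<open>Lattice point counts as sums over quotients\<close>

definition floor_sum :: "(nat \<Rightarrow> real) \<Rightarrow> nat \<Rightarrow> real" where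
  "floor_sum f n = (\<Sum>k=1..n. f (n div k))"

text \<open>
  Terms with \<open>k > n\<close> have \<open>n div k = 0\<close>; so the range of summation may be enlarged freely
  when \<open>f\<close> vanishes at 0.
\<close>

lemma floor_sum_extend:
  assumes "f 0 = 0" "n \<le> N"
  shows "floor_sum f n = (\<Sum>k=1..N. f (n div k))"
  unfolding floor_sum_def
  by (rule sum.mono_neutral_left) (use assms in auto)

lemma floor_sum_even:
  assumes "f 0 = 0"
  shows "(\<Sum>k | k \<in> {1..n} \<and> even k. f (n div k)) = floor_sum f (n div 2)"
  unfolding floor_sum_def
  by (rule sum.reindex_bij_witness[of _ "\<lambda>j. 2 * j" "\<lambda>k. k div 2"])
     (auto simp: div_mult2_eq elim!: evenE)

lemma floor_sum_split_parity:
  "floor_sum f n = (\<Sum>k | k \<in> {1..n} \<and> odd k. f (n div k)) + (\<Sum>k | k \<in> {1..n} \<and> even k. f (n div k))"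
proof -
  have "{1..n} = {k \<in> {1..n}. odd k} \<union> {k \<in> {1..n}. even k}" by auto
  hence "floor_sum f n = sum (\<lambda>k. f (n div k)) ({k \<in> {1..n}. odd k} \<union> {k \<in> {1..n}. even k})"
    unfolding floor_sum_def by (rule arg_cong)
  also have "\<dots> = (\<Sum>k | k \<in> {1..n} \<and> odd k. f (n div k)) + (\<Sum>k | k \<in> {1..n} \<and> even k. f (n div k))"
    by (rule sum.union_disjoint) auto
  finally show ?thesis .
qed

lemma floor_sum_odd:
  assumes "f 0 = 0"
  shows "(\<Sum>k | k \<in> {1..n} \<and> odd k. f (n div k)) = floor_sum f n - floor_sum f (n div 2)"
  using floor_sum_split_parity[of f n] floor_sum_even[of f, OF assms] by simp

lemma floor_sum_half:
  assumes "f 0 = 0"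
  shows "floor_sum (\<lambda>q. f (q div 2)) n = floor_sum f (n div 2)"
proof -
  have "n div k div 2 = n div 2 div k" for k by (metis div_mult2_eq mult.commute)
  thus ?thesis using floor_sum_extend[of f "n div 2" n] assms by (simp add: floor_sum_def)
qed

text \<open>
  Since \<open>q mod 2 = q - 2 (q div 2)\<close> and \<open>(n div k) div 2 = (n div 2) div k\<close>, a parity
  condition on the quotients becomes a combination of lattice point counts at \<open>n\<close> and \<open>n div 2\<close>.
\<close>

lemma floor_sum_parity: "floor_sum (\<lambda>q. real (q mod 2)) n = floor_sum real n - 2 * floor_sum real (n div 2)"
proof -
  have "real (q mod 2) = real q - 2 * real (q div 2)" for q
    using arg_cong[OF div_mult_mod_eq[of q 2], of real] unfolding of_nat_add of_nat_mult by simp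
  hence "floor_sum (\<lambda>q. real (q mod 2)) n = floor_sum real n - 2 * floor_sum (\<lambda>q. real (q div 2)) n"
    by (simp add: floor_sum_def sum_subtractf sum_distrib_left)
  thus ?thesis by (simp add: floor_sum_half)
qed

lemma N_H_eq_floor_sum:
  "real (N_H x) = floor_sum real (nat \<lfloor>x\<rfloor>)"
proof -
  define n where "n = nat \<lfloor>x\<rfloor>"
  have "{(a :: nat, b :: nat). a \<ge> 1 \<and> b \<ge> 1 \<and> real (a * b) \<le> x} = (SIGMA a:{1..n}. {1..n div a})"
  proof -
    have "real (a * b) \<le> x \<longleftrightarrow> a \<le> n \<and> b \<le> n div a" if "a \<ge> 1" "b \<ge> 1" for a b
    proof -
      have "real (a * b) \<le> x \<longleftrightarrow> a * b \<le> n"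
      proof
        assume "real (a * b) \<le> x"
        thus "a * b \<le> n" unfolding n_def by (rule le_nat_floor)
      next
        assume le: "a * b \<le> n"
        have "1 \<le> a * b" using that by simp
        hence "1 \<le> n" using le by linarith
        hence "real n \<le> x" unfolding n_def by linarith
        moreover have "real (a * b) \<le> real n" using le by (rule of_nat_mono)
        ultimately show "real (a * b) \<le> x" by linarith
      qed
      also have "\<dots> \<longleftrightarrow> a \<le> n \<and> b \<le> n div a"
        using that by (auto simp: less_eq_div_iff_mult_less_eq mult.commute intro: order_trans[of a "a * b"])
      finally show ?thesis .
    qed
    thus ?thesis by auto
  qed
  hence "N_H x = card (SIGMA a:{1..n}. {1..n div a})" by (simp add: N_H_def)
  also have "\<dots> = (\<Sum>a=1..n. n div a)" by simp
  finally show ?thesis by (simp add: floor_sum_def n_def)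
qed

text \<open>
  The summatory function of the character, which takes only the values 0 and 1.
\<close>

definition chi4_partial :: "nat \<Rightarrow> real" where
  "chi4_partial q = of_bool (q mod 4 = 1 \<or> q mod 4 = 2)"

lemma chi4_partial_eq_sum: "chi4_partial q = (\<Sum>m=1..q. of_int (chi4 (int m)))"
proof (induction q)
  case (Suc q)
  have "q mod 4 \<in> {0, 1, 2, 3}" by auto
  moreover have "int (Suc q) mod 4 = int (Suc q mod 4)" by (simp add: zmod_int)
  ultimately show ?case using Suc 
    by (auto simp: chi4_partial_def chi4_def mod_Suc)
qed (simp add: chi4_partial_def)

text \<open>
  By the two-square theorem the disc count is a sum of \<open>\<chi>(m)\<close> over all pairs with \<open>k m \<le> x\<close>;
  summing over \<open>m\<close> first gives partial sums of \<open>\<chi>\<close> at the quotients \<open>n div k\<close>.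
\<close>

lemma N_C_eq_floor_sum:
  assumes "x \<ge> 0"
  shows "real (N_C x) = 1 + 4 * floor_sum chi4_partial (nat \<lfloor>x\<rfloor>)"
proof -
  define n where "n = nat \<lfloor>x\<rfloor>"
  have x: "real_of_int m \<le> x \<longleftrightarrow> m \<le> int n" for m
    using assms by (simp add: n_def le_floor_iff)
  have "{(a :: int, b :: int). real_of_int (a\<^sup>2 + b\<^sup>2) \<le> x} = (\<Union>N\<in>{0..n}. two_square_reps (int N))"
  proof -
    have "a\<^sup>2 + b\<^sup>2 \<le> int n \<longleftrightarrow> (\<exists>N\<in>{0..n}. a\<^sup>2 + b\<^sup>2 = int N)" for a b :: int
      by (metis atLeast0AtMost atMost_iff of_nat_le_iff zero_le_imp_eq_int sum_power2_ge_zero)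
    thus ?thesis unfolding x by (auto simp: two_square_reps_def)
  qed
  hence "N_C x = card (\<Union>N\<in>{0..n}. two_square_reps (int N))" by (simp add: N_C_def)
  also have "\<dots> = (\<Sum>N=0..n. card (two_square_reps (int N)))"
    by (rule card_UN_disjoint) (auto simp: finite_two_square_reps, auto simp: two_square_reps_def)
  also have "\<dots> = card (two_square_reps 0) + (\<Sum>N=1..n. card (two_square_reps (int N)))"
    by (simp add: sum.atLeast_Suc_atMost)
  also have "two_square_reps 0 = {(0, 0)}" 
    by (auto simp: two_square_reps_def sum_power2_eq_zero_iff)
  finally have "int (N_C x) = 1 + (\<Sum>N=1..n. int (card (two_square_reps (int N))))" by simp
  also have "(\<Sum>N=1..n. int (card (two_square_reps (int N)))) = 
             4 * (\<Sum>N=1..n. \<Sum>(d, e)\<in>factor_pairs (int N). chi4 e)"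
    unfolding sum_distrib_left by (intro sum.cong refl) (simp add: Jacobi_two_squares flip: sum_distrib_left)
  also have "(\<Sum>N=1..n. \<Sum>(d, e)\<in>factor_pairs (int N). chi4 e) =
             (\<Sum>(N, d, e)\<in>(SIGMA N:{1..n}. factor_pairs (int N)). chi4 e)"
    by (subst sum.Sigma) (auto simp: finite_factor_pairs)
  also have "\<dots> = (\<Sum>(k, m)\<in>(SIGMA k:{1..n}. {1..n div k}). chi4 (int m))"
  proof (rule sum.reindex_bij_witness[of _ "\<lambda>(k, m). (k * m, int k, int m)" "\<lambda>(N, d, e). (nat d, nat e)"])
    fix x assume "x \<in> (SIGMA N:{1..n}. factor_pairs (int N))"
    then obtain N d e where x: "x = (N, d, e)" "N \<le> n" "d > 0" "e > 0" "d * e = int N"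
      by (auto simp: factor_pairs_def)
    have N: "N = nat d * nat e" using x by (simp flip: nat_mult_distrib)
    show "(case case x of (N, d, e) \<Rightarrow> (nat d, nat e) of (k, m) \<Rightarrow> (k * m, int k, int m)) = x"
      using x N by simp
    have "nat d \<le> N" using x N by simp
    hence "nat d \<le> n" using x by linarith
    thus "(case x of (N, d, e) \<Rightarrow> (nat d, nat e)) \<in> (SIGMA k:{1..n}. {1..n div k})"
      using x N by (auto simp: less_eq_div_iff_mult_less_eq mult.commute intro: order_trans)
    show "(case case x of (N, d, e) \<Rightarrow> (nat d, nat e) of (k, m) \<Rightarrow> chi4 (int m)) = 
          (case x of (N, d, e) \<Rightarrow> chi4 e)" using x by simp
  qed (auto simp: factor_pairs_def less_eq_div_iff_mult_less_eq mult.commute)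
  also have "\<dots> = (\<Sum>k=1..n. \<Sum>m=1..n div k. chi4 (int m))"
    by (subst sum.Sigma) auto
  finally have "real_of_int (int (N_C x)) = 
      real_of_int (1 + 4 * (\<Sum>k=1..n. \<Sum>m=1..n div k. chi4 (int m)))" by (rule arg_cong)
  thus ?thesis by (simp add: floor_sum_def chi4_partial_eq_sum n_def)
qed

section \<open>Dirichlet's estimate for the divisor problem\<close>

text \<open>
  Every lattice point under the hyperbola has a coordinate at most \<open>s\<close>, and the square
  \<open>{1..s} \<times> {1..s}\<close> is counted twice when the points with \<open>a \<le> s\<close> and those with \<open>b \<le> s\<close> are counted separately.
\<close>

lemma hyperbola_method:
  fixes n s :: nat
  assumes "s\<^sup>2 \<le> n" "n < (s + 1)\<^sup>2"
  shows "floor_sum real n = 2 * (\<Sum>a=1..s. real (n div a)) - (real s)\<^sup>2"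
proof -
  define H where "H = (SIGMA a:{1..n}. {1..n div a})"
  define A where "A = (SIGMA a:{1..s}. {1..n div a})"
  define B where "B = (\<lambda>(a, b). (b, a)) ` A"
  have H: "(a, b) \<in> H \<longleftrightarrow> a \<ge> 1 \<and> b \<ge> 1 \<and> a * b \<le> n" for a b
    by (auto simp: H_def less_eq_div_iff_mult_less_eq mult.commute intro: order_trans[of a "a * b"])
  have A: "(a, b) \<in> A \<longleftrightarrow> a \<ge> 1 \<and> b \<ge> 1 \<and> a \<le> s \<and> a * b \<le> n" for a b
    by (auto simp: A_def less_eq_div_iff_mult_less_eq mult.commute)
  have B: "(a, b) \<in> B \<longleftrightarrow> (b, a) \<in> A" for a b by (force simp: B_def)
  have small: "a \<le> s \<or> b \<le> s" if "a * b \<le> n" for a b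
  proof (rule ccontr)
    assume "\<not> ?thesis"
    hence "(s + 1) * (s + 1) \<le> a * b" by (intro mult_mono) auto
    thus False using that assms(2) by (simp add: power2_eq_square)
  qed
  hence "H = A \<union> B" by (auto simp: H A B mult.commute dest: small)
  moreover have "A \<inter> B = {1..s} \<times> {1..s}"
  proof -
    have "a * b \<le> n" if "a \<le> s" "b \<le> s" for a b
      using mult_mono[OF that] assms(1) by (simp add: power2_eq_square)
    thus ?thesis by (auto simp: A B mult.commute)
  qed
  moreover have "finite A" "finite B" by (auto simp: A_def B_def)
  moreover have "card B = card A" unfolding B_def by (rule card_image) (auto simp: inj_on_def)
  ultimately have "2 * card A = card H + s\<^sup>2"
    using card_Un_Int[of A B] by (simp add: power2_eq_square)
  moreover have "card H = (\<Sum>a=1..n. n div a)" "card A = (\<Sum>a=1..s. n div a)"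
    by (simp_all add: H_def A_def)
  ultimately have "2 * (\<Sum>a=1..s. n div a) = (\<Sum>a=1..n. n div a) + s\<^sup>2" by simp
  hence "real (2 * (\<Sum>a=1..s. n div a)) = real ((\<Sum>a=1..n. n div a) + s\<^sup>2)" by (rule arg_cong)
  thus ?thesis by (simp add: floor_sum_def)
qed

text \<open>
  The hyperbola method gives Dirichlet's estimate; only the bound \<open>o(x)\<close> is extracted.
  It is what excludes a component of exact order \<open>x\<close> when the error term is recovered from a linear
  recurrence whose homogeneous solutions include functions \<open>x p(log x)\<close> with \<open>p\<close> periodic.
\<close>

lemma Delta_H_over_x_tendsto_0: "((\<lambda>x. Delta_H x / x) \<longlongrightarrow> 0) at_top"
proof -
  define s where "s = (\<lambda>x::real. nat \<lfloor>sqrt x\<rfloor>)"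
  define g where "g = (\<lambda>x. 2 * (harm (s x) - ln (real (s x)) - euler_mascheroni) + ln ((real (s x) / sqrt x)\<^sup>2)
       + (1 - (real (s x) / sqrt x)\<^sup>2))"
  have s_top: "filterlim s at_top at_top"
    unfolding s_def
    by (rule filterlim_compose[OF filterlim_nat_sequentially])
       (rule filterlim_compose[OF filterlim_floor_sequentially sqrt_at_top])
  have ratio: "((\<lambda>x. real (s x) / sqrt x) \<longlongrightarrow> 1) at_top"
  proof -
    have "((\<lambda>x. of_int \<lfloor>sqrt x\<rfloor> / sqrt x) \<longlongrightarrow> 1) at_top"
      by real_asymp
    moreover have "eventually (\<lambda>x. of_int \<lfloor>sqrt x\<rfloor> / sqrt x = real (s x) / sqrt x) at_top"
      using eventually_ge_at_top[of "0::real"] by eventually_elim (simp add: s_def)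
    ultimately show ?thesis by (rule Lim_transform_eventually)
  qed
  have "((\<lambda>x. harm (s x) - ln (real (s x))) \<longlongrightarrow> (euler_mascheroni :: real)) at_top"
    by (rule filterlim_compose[OF euler_mascheroni_LIMSEQ s_top])
  hence "(g \<longlongrightarrow> 2 * (euler_mascheroni - euler_mascheroni) + ln (1\<^sup>2) + (1 - 1\<^sup>2)) at_top"
    unfolding g_def by (intro tendsto_intros ratio) auto
  hence g: "(g \<longlongrightarrow> 0) at_top" by simp
  have bound: "eventually (\<lambda>x. norm (Delta_H x / x - g x) \<le> 4 / sqrt x) at_top"
    using eventually_ge_at_top[of 1]
  proof eventually_elim
    fix x :: real assume x: "x \<ge> 1"
    define n where "n = nat \<lfloor>x\<rfloor>"
    have sx: "real (s x) \<le> sqrt x" "sqrt x < real (s x) + 1" "s x \<ge> 1"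
      using x by (auto simp: s_def le_nat_iff le_floor_iff)
    have nx: "real n \<le> x" "x < real n + 1" using x by (auto simp: n_def)
    have "real ((s x)\<^sup>2) \<le> x" 
      using power_mono[OF sx(1), of 2] x by simp
    hence le: "(s x)\<^sup>2 \<le> n" unfolding n_def by (rule le_nat_floor)
    have "real n < real ((s x + 1)\<^sup>2)"
      using power_strict_mono[OF sx(2), of 2] x nx(1) by (simp add: add.commute)
    hence lt: "n < (s x + 1)\<^sup>2" by (simp only: of_nat_less_iff)
    have div: "x / real a - 2 \<le> real (n div a)" "real (n div a) \<le> x / real a" if "a \<ge> 1" for a
    proof -
      have "real (n div a) \<le> real n / real a" by (rule of_nat_div_le_of_nat)
      also have "\<dots> \<le> x / real a" using nx by (intro divide_right_mono) auto
      finally show "real (n div a) \<le> x / real a" .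
      have "n < (n div a + 1) * a" using that dividend_less_div_times[of a n] by (simp add: add.commute)
      hence "real n < real ((n div a + 1) * a)" by (rule of_nat_less_iff[THEN iffD2])
      hence "real n < (real (n div a) + 1) * real a" by (simp add: algebra_simps)
      hence "x / real a < real (n div a) + 1 + 1 / real a" using nx that by (simp add: field_simps)
      also have "1 / real a \<le> 1" using that by simp
      finally show "x / real a - 2 \<le> real (n div a)" by simp
    qed
    define S where "S = (\<Sum>a=1..s x. real (n div a))"
    have hs: "x * harm (s x) = (\<Sum>a=1..s x. x / real a)"
      by (simp add: harm_def sum_distrib_left divide_inverse)
    have "S \<le> x * harm (s x)" unfolding S_def hs by (intro sum_mono div) auto
    moreover have "(\<Sum>a=1..s x. x / real a - 2) \<le> S" unfolding S_def by (intro sum_mono div) auto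
    hence "x * harm (s x) - 2 * real (s x) \<le> S" unfolding sum_subtractf hs by simp
    ultimately have S: "\<bar>S - x * harm (s x)\<bar> \<le> 2 * sqrt x" using sx(1) by linarith
    have "Delta_H x = 2 * S - (real (s x))\<^sup>2 - (x * ln x + (2 * euler_mascheroni - 1) * x)"
      using hyperbola_method[OF le lt] by (simp add: Delta_H_def N_H_eq_floor_sum S_def n_def)
    moreover have "x * g x = 2 * x * harm (s x) - (real (s x))\<^sup>2 - (x * ln x + (2 * euler_mascheroni - 1) * x)"
      using x sx(3) by (simp add: g_def ln_div ln_realpow power_divide algebra_simps ln_sqrt)
    ultimately have "Delta_H x - x * g x = 2 * (S - x * harm (s x))" by simp
    hence "\<bar>Delta_H x - x * g x\<bar> \<le> 4 * sqrt x" using S by simp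
    hence "\<bar>Delta_H x - x * g x\<bar> / x \<le> 4 * sqrt x / x" using x by (intro divide_right_mono) auto
    moreover have "4 * sqrt x / x = 4 / sqrt x" using x by (simp add: field_simps)
    moreover have "Delta_H x / x - g x = (Delta_H x - x * g x) / x" using x by (simp add: field_simps)
    ultimately show "norm (Delta_H x / x - g x) \<le> 4 / sqrt x" using x by simp
  qed
  have "((\<lambda>x::real. 4 / sqrt x) \<longlongrightarrow> 0) at_top" by real_asymp
  from Lim_null_comparison[OF bound this]
  have "((\<lambda>x. Delta_H x / x - g x) \<longlongrightarrow> 0) at_top" .
  from tendsto_add[OF this g] show ?thesis by simp
qed

section \<open>Inverting recurrences under halving of the argument\<close>

lemma halving_induct [consumes 1, case_names base step]:
  fixes x :: real
  assumes "x > 0" "\<And>x. 0 < x \<Longrightarrow> x < 1 \<Longrightarrow> P x" "\<And>x. x \<ge> 1 \<Longrightarrow> P (x / 2) \<Longrightarrow> P x"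
  shows "P x"
proof -
  have "P x" if "0 < x" "x < 2 ^ i" for i x
    using that
  proof (induction i arbitrary: x)
    case (Suc i)
    thus ?case using assms(2,3)[of x] by (cases "x < 1") auto
  qed (use assms(2) in auto)
  moreover obtain i where "x < 2 ^ i" using real_arch_pow[of 2 x] by auto
  ultimately show ?thesis using assms(1) by blast
qed

text \<open>
  Iterating the difference down to arguments below 1 sums a geometric series with ratio
  \<open>2 powr (- s)\<close>; the constant \<open>c\<close> is the sum of that series.
\<close>

lemma bound_from_halving_difference:
  fixes D :: "real \<Rightarrow> real"
  assumes "s > 0" "K \<ge> 0"
  assumes g: "\<And>x. x \<ge> 1 \<Longrightarrow> \<bar>D x - D (x / 2)\<bar> \<le> K * x powr s"
  assumes B: "\<And>x. 0 < x \<Longrightarrow> x < 1 \<Longrightarrow> \<bar>D x\<bar> \<le> B"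
  obtains C where "\<And>x. x \<ge> 1 \<Longrightarrow> \<bar>D x\<bar> \<le> C * x powr s"
proof -
  define r where "r = (2::real) powr (-s)"
  have r: "0 < r" "r < 1" using assms(1) by (auto simp: r_def powr_less_one)
  define c where "c = K / (1 - r)"
  have c: "c \<ge> 0" "K + c * r = c" using r assms(2) by (auto simp: c_def field_simps)
  have B0: "B \<ge> 0" using B[of "1/2"] by auto
  have main: "\<bar>D x\<bar> \<le> B + c * x powr s" if "x > 0" for x
    using that
  proof (induction x rule: halving_induct)
    case (base x)
    have "c * x powr s \<ge> 0" using c by simp
    thus ?case using B[OF base] by linarith
  next
    case (step x)
    have "(x / 2) powr s = x powr s * r" using step by (simp add: r_def powr_divide powr_minus_divide)
    hence "\<bar>D x\<bar> \<le> K * x powr s + (B + c * (x powr s * r))"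
      using g[of x] step by simp
    also have "\<dots> = B + (K + c * r) * x powr s" by (simp add: algebra_simps)
    finally show ?case unfolding c(2) .
  qed
  show ?thesis
  proof (rule that[of "B + c"])
    fix x :: real assume x: "x \<ge> 1"
    hence "B * 1 \<le> B * x powr s" using B0 assms(1) by (intro mult_left_mono ge_one_powr_ge_zero) auto
    thus "\<bar>D x\<bar> \<le> (B + c) * x powr s" using main[of x] x by (simp add: algebra_simps)
  qed
qed

text \<open>
  Going downwards from \<open>x\<close> would amplify the error by 2 at each halving. So the relation is
  iterated upwards: \<open>D x / x\<close> differs from \<open>D (2 x) / (2 x)\<close> by \<open>O(x powr (s - 1))\<close>, the
  differences along \<open>2 ^ N * x\<close> form a convergent geometric series because \<open>s < 1\<close>, and the limit is 0
  by hypothesis.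
\<close>

lemma bound_from_doubling:
  fixes D :: "real \<Rightarrow> real"
  assumes "s < 1" "A \<ge> 0"
  assumes h: "\<And>x. x \<ge> 1 \<Longrightarrow> \<bar>D (2 * x) - 2 * D x\<bar> \<le> A * (2 * x) powr s"
  assumes lim: "((\<lambda>x. D x / x) \<longlongrightarrow> 0) at_top"
  obtains C where "\<And>x. x \<ge> 1 \<Longrightarrow> \<bar>D x\<bar> \<le> C * x powr s"
proof -
  define r where "r = (2::real) powr (s - 1)"
  have r: "0 < r" "r < 1" using assms(1) by (auto simp: r_def powr_less_one)
  \<comment> \<open>With this \<open>c\<close> the function \<open>v\<close> below cannot decrease when its argument is doubled.\<close>
  define c where "c = A * r / (1 - r)"
  have c: "A * r + c * r = c" using r by (simp add: c_def field_simps)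
  define v where "v = (\<lambda>x. \<bar>D x / x\<bar> - c * x powr (s - 1))"
  have v_step: "v x \<le> v (2 * x)" if x: "x \<ge> 1" for x
  proof -
    have p: "(2 * x) powr (s - 1) = r * x powr (s - 1)" using x by (simp add: r_def powr_mult)
    have "D x / x = D (2 * x) / (2 * x) - (D (2 * x) - 2 * D x) / (2 * x)"
      using x by (simp add: field_simps)
    hence "\<bar>D x / x\<bar> \<le> \<bar>D (2 * x) / (2 * x)\<bar> + \<bar>(D (2 * x) - 2 * D x) / (2 * x)\<bar>" by linarith
    moreover have "\<bar>(D (2 * x) - 2 * D x) / (2 * x)\<bar> \<le> A * (2 * x) powr s / (2 * x)"
      using h[OF x] x by (simp add: abs_divide divide_right_mono)
    moreover have "A * (2 * x) powr s / (2 * x) = A * (r * x powr (s - 1))"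
    proof -
      have "(2 * x) powr s / (2 * x) = r * x powr (s - 1)"
        using x p powr_diff[of "2 * x" s 1] by simp
      thus ?thesis by (metis times_divide_eq_right)
    qed
    moreover have "A * (r * x powr (s - 1)) + c * (r * x powr (s - 1)) = c * x powr (s - 1)"
    proof -
      have "A * (r * y) + c * (r * y) = (A * r + c * r) * y" for y by (simp add: algebra_simps)
      thus ?thesis unfolding c .
    qed
    ultimately show ?thesis unfolding v_def p by linarith
  qed
  have v_pow: "v x \<le> v (2 ^ N * x)" if x: "x \<ge> 1" for x N
  proof (induction N)
    case (Suc N)
    have "1 * 1 \<le> 2 ^ N * x" using x by (intro mult_mono) auto
    hence "v (2 ^ N * x) \<le> v (2 * (2 ^ N * x))" by (intro v_step) simp
    thus ?case using Suc by (simp add: mult.assoc)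
  qed simp
  have "(v \<longlongrightarrow> \<bar>0\<bar> - c * 0) at_top"
    unfolding v_def 
    by (intro tendsto_intros lim tendsto_neg_powr filterlim_ident) (use assms(1) in auto)
  hence v_lim: "(v \<longlongrightarrow> 0) at_top" by simp
  have "v x \<le> 0" if x: "x \<ge> 1" for x
  proof -
    have "filterlim (\<lambda>N. 2 ^ N * x) at_top sequentially"
      using x by real_asymp
    hence "(\<lambda>N. v (2 ^ N * x)) \<longlonglongrightarrow> 0" by (rule filterlim_compose[OF v_lim])
    moreover have "eventually (\<lambda>N. v x \<le> v (2 ^ N * x)) sequentially"
      by (intro always_eventually allI v_pow x)
    ultimately show ?thesis by (rule tendsto_lowerbound) simp
  qed
  hence quot: "\<bar>D x / x\<bar> \<le> c * x powr (s - 1)" if "x \<ge> 1" for x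
    using that by (simp add: v_def)
  have "\<bar>D x\<bar> \<le> c * x powr s" if x: "x \<ge> 1" for x
  proof -
    have "\<bar>D x\<bar> = \<bar>D x / x\<bar> * x" using x by (simp add: abs_divide)
    also have "\<dots> \<le> c * x powr (s - 1) * x" using quot[OF x] x by (intro mult_right_mono) auto
    also have "\<dots> = c * (x powr (s - 1) * x powr 1)" using x by simp
    also have "\<dots> = c * x powr s" unfolding powr_add [symmetric] by simp
    finally show ?thesis .
  qed
  thus ?thesis by (rule that)
qed

text \<open>
  With \<open>S\<close> for the operator \<open>D x \<mapsto> D (x / 2)\<close>, the polynomial \<open>2 - 5 S + 2 S\<^sup>2\<close> factors as
  \<open>(2 - S) (1 - 2 S)\<close>. The first factor is inverted by a contraction running downwards, the second by
  the upward iteration above.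
\<close>

lemma bound_from_second_order_recurrence:
  fixes D :: "real \<Rightarrow> real"
  assumes "0 < s" "s < 1"
  assumes g: "\<And>x. x \<ge> 1 \<Longrightarrow> \<bar>2 * D x - 5 * D (x / 2) + 2 * D (x / 4)\<bar> \<le> K * x powr s"
  assumes B: "\<And>x. 0 < x \<Longrightarrow> x < 1 \<Longrightarrow> \<bar>D x\<bar> \<le> B"
  assumes lim: "((\<lambda>x. D x / x) \<longlongrightarrow> 0) at_top"
  obtains C where "\<And>x. x \<ge> 1 \<Longrightarrow> \<bar>D x\<bar> \<le> C * x powr s"
proof -
  define h where "h = (\<lambda>x. D x - 2 * D (x / 2))"
  define A where "A = max K (3 * B)"
  have A: "A \<ge> K" "A \<ge> 3 * B" "A \<ge> 0" using B[of "1/2"] by (auto simp: A_def)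
  have h_bound: "\<bar>h x\<bar> \<le> A * max 1 (x powr s)" if "x > 0" for x
    using that
  proof (induction x rule: halving_induct)
    case (base x)
    have "\<bar>h x\<bar> \<le> A * 1" using B[of x] B[of "x / 2"] base A unfolding h_def by auto
    also have "\<dots> \<le> A * max 1 (x powr s)" using A by (intro mult_left_mono) auto
    finally show ?case .
  next
    case (step x)
    have x1: "1 \<le> x powr s" using step assms(1) by (intro ge_one_powr_ge_zero) auto
    have "(x / 2) powr s \<le> x powr s" using step assms(1) by (intro powr_mono2) auto
    hence "A * max 1 ((x / 2) powr s) \<le> A * x powr s" using x1 A by (intro mult_left_mono) auto
    hence half: "\<bar>h (x / 2)\<bar> \<le> A * x powr s" using step by linarith
    have "K * x powr s \<le> A * x powr s" using A by (intro mult_right_mono) auto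
    moreover have "2 * h x = (2 * D x - 5 * D (x / 2) + 2 * D (x / 4)) + h (x / 2)"
      by (simp add: h_def)
    ultimately have "\<bar>h x\<bar> \<le> A * x powr s" using g[of x] step half by linarith
    thus ?case using x1 by simp
  qed
  show ?thesis
  proof (rule bound_from_doubling[OF assms(2) A(3) _ lim])
    fix x :: real assume x: "x \<ge> 1"
    have "1 \<le> (2 * x) powr s" using x assms(1) by (intro ge_one_powr_ge_zero) auto
    thus "\<bar>D (2 * x) - 2 * D x\<bar> \<le> A * (2 * x) powr s"
      using h_bound[of "2 * x"] x by (simp add: h_def)
  qed (rule that)
qed

section \<open>The divisor bound\<close>

definition divisor_count :: "nat \<Rightarrow> nat" where
  "divisor_count n = card {d. d dvd n}"

lemma divisor_count_prime_power_mult: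
  assumes "prime p" "m > 0"
  shows "divisor_count (p ^ a * m) \<le> (a + 1) * divisor_count m"
proof -
  have "{d. d dvd p ^ a * m} \<subseteq> (\<lambda>(i, e). p ^ i * e) ` ({..a} \<times> {e. e dvd m})"
  proof
    fix d assume "d \<in> {d. d dvd p ^ a * m}"
    then obtain b c where d: "d = b * c" "b dvd p ^ a" "c dvd m" by (auto elim: dvd_productE)
    then obtain i where "i \<le> a" "b = p ^ i" using divides_primepow_nat[OF assms(1)] by auto
    with d show "d \<in> (\<lambda>(i, e). p ^ i * e) ` ({..a} \<times> {e. e dvd m})" by force
  qed
  hence "card {d. d dvd p ^ a * m} \<le> card ((\<lambda>(i, e). p ^ i * e) ` ({..a} \<times> {e. e dvd m}))"
    using assms by (intro card_mono) auto
  also have "\<dots> \<le> card ({..a} \<times> {e. e dvd m})"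
    using assms by (intro card_image_le) auto
  finally show ?thesis by (simp add: divisor_count_def card_cartesian_product)
qed

text \<open>
  The function \<open>divisor_count\<close> is submultiplicative over prime powers. A factor
  \<open>a + 1\<close> is at most \<open>(p ^ a) powr \<epsilon>\<close> when \<open>p \<ge> 2 powr (1 / \<epsilon>)\<close>, and the finitely many smaller
  primes cost one constant factor \<open>c\<close> each.
\<close>

lemma divisor_count_bound:
  assumes "\<epsilon> > 0"
  obtains C where "C \<ge> 0" "\<And>n. n > 0 \<Longrightarrow> real (divisor_count n) \<le> C * real n powr \<epsilon>"
proof -
  \<comment> \<open>The bound \<open>ln y \<le> y\<close> at \<open>y = (2 ^ a) powr \<epsilon>\<close> gives \<open>a + 1 \<le> c * y\<close>.\<close>
  define c where "c = 1 + 1 / (\<epsilon> * ln 2)"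
  have c: "c \<ge> 1" using assms by (simp add: c_def)
  have small: "real (a + 1) \<le> c * (real p ^ a) powr \<epsilon>" if "p \<ge> 2" for a p :: nat
  proof -
    have "real a * \<epsilon> * ln 2 \<le> ln ((2 ^ a) powr \<epsilon>)" by (simp add: ln_powr ln_realpow)
    also have "\<dots> \<le> (2 ^ a) powr \<epsilon>" by (rule ln_bound) auto
    finally have "real a \<le> (2 ^ a) powr \<epsilon> / (\<epsilon> * ln 2)"
      using assms by (simp add: field_simps)
    moreover have "1 \<le> (2 ^ a :: real) powr \<epsilon>" using assms by (intro ge_one_powr_ge_zero) auto
    ultimately have "real (a + 1) \<le> c * (2 ^ a) powr \<epsilon>" by (simp add: c_def algebra_simps)
    also have "\<dots> \<le> c * (real p ^ a) powr \<epsilon>"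
      using that c assms by (intro mult_left_mono powr_mono2 power_mono) auto
    finally show ?thesis .
  qed
  have large: "real (a + 1) \<le> (real p ^ a) powr \<epsilon>" if "2 powr (1/\<epsilon>) \<le> real p" for a p :: nat
  proof -
    have "2 = (2 powr (1/\<epsilon>)) powr \<epsilon>" using assms by (simp add: powr_powr)
    also have "\<dots> \<le> real p powr \<epsilon>" using that assms by (intro powr_mono2) auto
    finally have "2 ^ a \<le> (real p powr \<epsilon>) ^ a" by (intro power_mono) auto
    moreover have "real (a + 1) \<le> 2 ^ a"
      using of_nat_mono[OF less_exp[of a, THEN Suc_leI], where ?'a = real] by simp
    moreover have "(real p powr \<epsilon>) ^ a = (real p ^ a) powr \<epsilon>"
    proof -
      have "0 < (2::real) powr (1/\<epsilon>)" by simp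
      hence "p > 0" using that by (cases p) (auto simp del: powr_gt_zero)
      thus ?thesis by (simp add: powr_power powr_realpow[symmetric] powr_powr mult.commute)
    qed
    ultimately show ?thesis by linarith
  qed
  define P where "P = {p. prime p \<and> real p < 2 powr (1/\<epsilon>)}"
  have "P \<subseteq> {..nat \<lfloor>2 powr (1/\<epsilon>)\<rfloor>}" by (auto simp: P_def intro!: le_nat_floor)
  hence fin: "finite P" by (rule finite_subset) auto
  have main: "real (divisor_count n) \<le> c ^ card (prime_factors n \<inter> P) * real n powr \<epsilon>" if "n > 0" for n
    using that
  proof (induction n rule: less_induct)
    case (less n)
    show ?case
    proof (cases "n = 1")
      case True
      thus ?thesis by (simp add: divisor_count_def)
    next
      case False
      then obtain p where p: "prime p" "p dvd n" using prime_factor_nat by blast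
      define a where "a = multiplicity p n"
      obtain m where m: "n = p ^ a * m" "\<not> p dvd m"
        using less.prems p(1) unfolding a_def by (metis multiplicity_decompose' not_prime_unit not_gr_zero)
      have "a > 0" using p(2) m by (cases "a = 0") auto
      have m0: "m > 0" using m less.prems by (cases m) auto
      have p2: "p \<ge> 2" using p(1) prime_ge_2_nat by blast
      have "p ^ a > 1" using p2 \<open>a > 0\<close> by (intro one_less_power) auto
      hence "m < n" using m0 by (simp add: m(1))
      have pow: "q = p" if "prime q" "q dvd p ^ a" for q
        using that p(1) by (meson prime_dvd_power primes_dvd_imp_eq)
      have pf: "prime_factors n = insert p (prime_factors m)" "p \<notin> prime_factors m"
        using m p m0 less.prems
        by (auto simp: prime_factors_dvd prime_dvd_mult_iff dest: pow)
      have step: "c ^ card (prime_factors m \<inter> P) * real (a + 1) \<le> c ^ card (prime_factors n \<inter> P) * (real p ^ a) powr \<epsilon>"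
      proof (cases "p \<in> P")
        case True
        hence "card (prime_factors n \<inter> P) = Suc (card (prime_factors m \<inter> P))"
          using pf by simp
        thus ?thesis using small[OF p2, of a] c by (simp add: mult_ac)
      next
        case False
        hence "prime_factors n \<inter> P = prime_factors m \<inter> P" using pf by auto
        moreover have "real (a + 1) \<le> (real p ^ a) powr \<epsilon>"
          using False p(1) by (intro large) (auto simp: P_def)
        ultimately show ?thesis using c by (simp add: mult_left_mono)
      qed
      have "real (divisor_count n) \<le> real (a + 1) * real (divisor_count m)"
        using divisor_count_prime_power_mult[OF p(1) m0, of a] m(1) 
        by (metis of_nat_le_iff of_nat_mult)
      also have "\<dots> \<le> real (a + 1) * (c ^ card (prime_factors m \<inter> P) * real m powr \<epsilon>)"
        by (intro mult_left_mono less.IH \<open>m < n\<close> m0) auto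
      also have "\<dots> = (c ^ card (prime_factors m \<inter> P) * real (a + 1)) * real m powr \<epsilon>" by simp
      also have "\<dots> \<le> (c ^ card (prime_factors n \<inter> P) * (real p ^ a) powr \<epsilon>) * real m powr \<epsilon>"
        by (intro mult_right_mono step) auto
      also have "\<dots> = c ^ card (prime_factors n \<inter> P) * real n powr \<epsilon>"
        by (simp add: m(1) powr_mult)
      finally show ?thesis .
    qed
  qed
  show ?thesis
  proof (rule that[of "c ^ card P"])
    fix n :: nat assume "n > 0"
    have "c ^ card (prime_factors n \<inter> P) \<le> c ^ card P"
      using c fin by (intro power_increasing card_mono) auto
    hence "c ^ card (prime_factors n \<inter> P) * real n powr \<epsilon> \<le> c ^ card P * real n powr \<epsilon>"
      by (intro mult_right_mono) auto
    thus "real (divisor_count n) \<le> c ^ card P * real n powr \<epsilon>" using main[OF \<open>n > 0\<close>] by linarith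
  qed (use c in auto)
qed

section \<open>Fibonacci numbers modulo Fibonacci numbers\<close>

lemma fib_add_cong: 
  assumes "k > 0" shows "[int (fib (k + m)) = int (fib (k - 1)) * int (fib m)] (mod int (fib k))"
proof -
  obtain j where k: "k = Suc j" using assms by (cases k) auto
  show ?thesis using fib_add[of m j] by (simp add: k add.commute cong_iff_lin)
     (rule exI[of _ "- int (fib (Suc m))"], simp add: algebra_simps)
qed

text \<open>
  Cassini's identity modulo \<open>fib k\<close>. It makes \<open>fib (k - 1)\<close> a square root of \<open>\<plusminus>1\<close>, so that
  shifting the index by \<open>2 k\<close> only changes a sign.
\<close>

lemma fib_pred_square_cong:
  assumes "k > 0" shows "[int (fib (k - 1)) ^ 2 = (-1) ^ k] (mod int (fib k))"
proof -
  obtain j where k: "k = Suc j" using assms by (cases k) auto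
  have "(int (fib j))\<^sup>2 - (- 1) ^ k = int (fib k) * (int (fib k) - int (fib j))"
    using fib_Cassini_int[of j] by (simp add: k algebra_simps power2_eq_square)
  thus ?thesis using k by (simp add: cong_iff_dvd_diff)
qed

lemma fib_add_even_multiple_cong:
  assumes "k > 0" 
  shows "[int (fib (2 * j * k + m)) = (-1) ^ (k * j) * int (fib m)] (mod int (fib k))"
proof (induction j)
  case (Suc j)
  have "2 * Suc j * k + m = k + (k + (2 * j * k + m))" by (simp add: algebra_simps)
  also have "[int (fib (k + (k + (2 * j * k + m)))) = int (fib (k - 1)) * int (fib (k + (2 * j * k + m)))] (mod int (fib k))"
    using assms by (rule fib_add_cong)
  also have "[int (fib (k - 1)) * int (fib (k + (2 * j * k + m))) = 
       int (fib (k - 1)) * (int (fib (k - 1)) * int (fib (2 * j * k + m)))] (mod int (fib k))"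
    using assms by (intro cong_mult cong_refl fib_add_cong)
  also have "int (fib (k - 1)) * (int (fib (k - 1)) * int (fib (2 * j * k + m))) = 
        int (fib (k - 1)) ^ 2 * int (fib (2 * j * k + m))"
    by (simp add: power2_eq_square)
  also have "[int (fib (k - 1)) ^ 2 * int (fib (2 * j * k + m)) = (-1) ^ k * ((-1) ^ (k * j) * int (fib m))] (mod int (fib k))"
    using assms by (intro cong_mult Suc fib_pred_square_cong)
  also have "(-1) ^ k * ((-1) ^ (k * j) * int (fib m)) = (-1) ^ (k * Suc j) * int (fib m)"
    by (simp add: power_add)
  finally show ?case .
qed simp

text \<open>
  Both sides satisfy the Fibonacci recurrence in \<open>r\<close>.
\<close>

lemma fib_reflect_cong:
  assumes "k > 0"
  shows "r \<le> k \<Longrightarrow> [int (fib (k + r)) = (-1) ^ (r + 1) * int (fib (k - r))] (mod int (fib k))"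
proof (induction r rule: fib.induct)
  case 1
  show ?case by (simp add: cong_iff_dvd_diff)
next
  case 2
  show ?case using fib_add_cong[OF assms, of 1] by simp
next
  case (3 r)
  define j where "j = k - Suc (Suc r)"
  have j: "k - r = Suc (Suc j)" "k - Suc r = Suc j" "k - Suc (Suc r) = j" using 3 by (auto simp: j_def)
  have "[int (fib (k + Suc r)) + int (fib (k + r)) = 
          (-1) ^ (Suc r + 1) * int (fib (k - Suc r)) + (-1) ^ (r + 1) * int (fib (k - r))] (mod int (fib k))"
    using 3 by (intro cong_add) auto
  thus ?case unfolding j by (simp add: algebra_simps)
qed

text \<open>
  Dividing the index \<open>n\<close> by \<open>k\<close> reduces \<open>fib n\<close> modulo \<open>fib k\<close> to \<open>\<plusminus> fib t\<close> with \<open>t \<le> k\<close>.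
  This predicate says when the sign is negative; \<open>t\<close> is \<open>fib_idx n k\<close>.
\<close>

definition fib_neg :: "nat \<Rightarrow> nat \<Rightarrow> bool" where
  "fib_neg n k = (let q = n div k; r = n mod k in
     if even q then odd (k * (q div 2)) else odd (k * (q div 2) + r + 1))"

definition fib_idx :: "nat \<Rightarrow> nat \<Rightarrow> nat" where
  "fib_idx n k = (if even (n div k) then n mod k else k - n mod k)"

lemma fib_mod_fib:
  assumes "k > 0"
  shows "[int (fib n) = (if fib_neg n k then -1 else 1) * int (fib (fib_idx n k))] (mod int (fib k))"
proof -
  define q r where "q = n div k" and "r = n mod k"
  have n: "n = q * k + r" and r: "r < k" using assms by (simp_all add: q_def r_def)
  have sgn: "(if odd a then -1 else 1) = (-1 :: int) ^ a" for a by simp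
  show ?thesis
  proof (cases "even q")
    case True
    hence "n = 2 * (q div 2) * k + r" using n by simp
    hence "[int (fib n) = (-1) ^ (k * (q div 2)) * int (fib r)] (mod int (fib k))"
      using fib_add_even_multiple_cong[OF assms, of "q div 2" r] by metis
    thus ?thesis using True
      by (simp only: fib_neg_def fib_idx_def Let_def q_def[symmetric] r_def[symmetric] if_True sgn)
  next
    case False
    hence "q * k = (2 * (q div 2) + 1) * k" by simp
    hence "n = 2 * (q div 2) * k + (k + r)" using n by (simp add: algebra_simps)
    hence "[int (fib n) = (-1) ^ (k * (q div 2)) * int (fib (k + r))] (mod int (fib k))"
      using fib_add_even_multiple_cong[OF assms, of "q div 2" "k + r"] by metis
    also have "[(-1) ^ (k * (q div 2)) * int (fib (k + r)) = 
                (-1) ^ (k * (q div 2)) * ((-1) ^ (r + 1) * int (fib (k - r)))] (mod int (fib k))"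
      using r by (intro cong_mult cong_refl fib_reflect_cong assms) auto
    also have "(-1) ^ (k * (q div 2)) * ((-1) ^ (r + 1) * int (fib (k - r))) = 
               (-1) ^ (k * (q div 2) + r + 1) * int (fib (k - r))" by (simp add: power_add)
    finally show ?thesis using False
      by (simp only: fib_neg_def fib_idx_def Let_def q_def[symmetric] r_def[symmetric] if_False sgn)
  qed
qed

text \<open>
  Up to an integer \<open>a / b\<close> is \<open>t / b\<close> or \<open>- t / b\<close>, so its fractional part lies within \<open>t / b\<close>
  above 0, respectively below 1. The only exception is \<open>t = 0\<close> with a negative sign, where it is 0
  instead of 1.
\<close>

lemma frac_divide_cong:
  fixes a t b :: int
  assumes "[a = (if neg then -1 else 1) * t] (mod b)" "b > 0" "0 \<le> t" "t \<le> b"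
  shows "\<bar>frac (a / b) - of_bool neg\<bar> \<le> t / b + of_bool (t = 0)"
proof -
  obtain m where a: "a = (if neg then -1 else 1) * t + b * m"
    using assms(1) by (metis cong_iff_lin cong_sym)
  have "real_of_int a / b = (if neg then -1 else 1) * (t / b) + of_int m"
    using assms(2) by (simp add: a field_simps)
  hence *: "frac (a / b) = frac ((if neg then -1 else 1) * (real_of_int t / b))"
    by (simp add: frac_def)
  define u where "u = real_of_int t / b"
  have u: "0 \<le> u" "u \<le> 1" "u = 0 \<longleftrightarrow> t = 0" using assms by (auto simp: u_def)
  have "\<bar>frac ((if neg then -1 else 1) * u) - of_bool neg\<bar> \<le> u + of_bool (u = 0)"
  proof (cases "u = 0 \<or> u = 1")
    case True
    thus ?thesis using frac_of_int[of "-1", where ?'a = real] frac_of_int[of "1", where ?'a = real] by (auto simp: frac_def)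
  next
    case False
    hence "frac u = u" "u > 0" using u frac_eq[of u] by auto
    moreover have "frac (-u) = 1 - u" using False u by (subst frac_unique_iff) auto
    ultimately show ?thesis by auto
  qed
  thus ?thesis unfolding * u(3) unfolding u_def .
qed

text \<open>
  From \<open>fib (t + 2) \<ge> 2 fib t\<close>; the rate \<open>3/4\<close> satisfies \<open>2 (3/4)\<^sup>2 \<ge> 1\<close>, and the factor 2
  absorbs the exceptional step \<open>fib 1 = fib 2\<close>.
\<close>

lemma fib_growth: "real (fib t) \<le> 2 * (3/4) ^ e * real (fib (t + e))"
proof (induction e rule: fib.induct)
  case 2
  show ?case by (cases t) (auto simp: fib_Suc_mono)
next
  case (3 e)
  have "2 * real (fib (t + e)) \<le> real (fib (t + Suc (Suc e)))"
    using fib_Suc_mono[of "t + e"] by simp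
  note step = this
  have "real (fib t) \<le> 2 * (3/4) ^ e * real (fib (t + e))" by (rule 3)
  also have "\<dots> = (3/4) ^ e * (2 * real (fib (t + e)))" by simp
  also have "\<dots> \<le> (3/4) ^ e * real (fib (t + Suc (Suc e)))"
    using step by (intro mult_left_mono) auto
  also have "\<dots> \<le> 2 * (3/4) ^ Suc (Suc e) * real (fib (t + Suc (Suc e)))"
    by (intro mult_right_mono) auto
  finally show ?case .
qed simp

text \<open>
  The error \<open>fib t / fib k\<close> decays geometrically in \<open>k - t\<close>, which is the distance from \<open>n\<close>
  to the multiple \<open>(q + 1) k\<close> above it for even \<open>q\<close>, and to the multiple \<open>q k\<close> below it for odd \<open>q\<close>. The
  term \<open>of_bool (k dvd n)\<close> accounts for vanishing residues.
\<close>

lemma fib_term_error: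
  assumes "k \<in> {1..n}"
  shows "\<bar>frac (real (fib n) / real (fib k)) - of_bool (fib_neg n k)\<bar> \<le>
     2 * (\<Sum>e<n. (3/4) ^ e * (of_bool (k dvd n + e) + of_bool (k dvd n - e))) + of_bool (k dvd n)"
proof -
  define q r t where "q = n div k" and "r = n mod k" and "t = fib_idx n k"
  have k: "k > 0" "k \<le> n" using assms by auto
  have n: "n = q * k + r" and r: "r < k" using k by (simp_all add: q_def r_def)
  have q: "q \<ge> 1" using k unfolding q_def by (simp add: Suc_leI div_greater_zero_iff)
  have t: "t = (if even q then r else k - r)" by (simp add: t_def fib_idx_def q_def r_def)
  have tk: "t \<le> k" using r by (auto simp: t)
  define S where "S = (\<Sum>e<n. (3/4::real) ^ e * (of_bool (k dvd n + e) + of_bool (k dvd n - e)))"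
  have "\<bar>frac (real_of_int (int (fib n)) / real_of_int (int (fib k))) - of_bool (fib_neg n k)\<bar> \<le> 
     real_of_int (int (fib t)) / real_of_int (int (fib k)) + of_bool (int (fib t) = 0)"
    unfolding t_def
    by (rule frac_divide_cong[OF fib_mod_fib]) 
       (use k tk in \<open>auto simp: fib_neq_0_nat t_def intro!: fib_mono\<close>)
  hence "\<bar>frac (real (fib n) / real (fib k)) - of_bool (fib_neg n k)\<bar> \<le> 
     real (fib t) / real (fib k) + of_bool (fib t = 0)" by simp
  moreover have "of_bool (fib t = 0) \<le> (of_bool (k dvd n) :: real)"
  proof (cases "fib t = 0")
    case True
    hence "t = 0" using fib_neq_0_nat[of t] by auto
    hence "r = 0" using r by (auto simp: t split: if_splits)
    thus ?thesis by (simp add: r_def dvd_eq_mod_eq_0)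
  qed simp
  moreover have "real (fib t) / real (fib k) \<le> 2 * (3/4) ^ (k - t)"
    using fib_growth[of t "k - t"] tk fib_neq_0_nat[OF k(1)] by (simp add: field_simps)
  moreover have "(3/4) ^ (k - t) \<le> S"
  proof -
    have "k - t < n \<and> (k dvd n + (k - t) \<or> k dvd n - (k - t))"
    proof (cases "even q")
      case True
      hence "q \<ge> 2" using q by presburger
      hence "2 * k \<le> n" using mult_le_mono1[of 2 q k] n by linarith
      moreover have "n + (k - t) = (q + 1) * k" using True r n by (simp add: t)
      ultimately show ?thesis using k by simp
    next
      case False
      hence "k - t = r" using r by (simp add: t)
      thus ?thesis using n r k q by simp
    qed
    hence lt: "k - t \<in> {..<n}" and "k dvd n + (k - t) \<or> k dvd n - (k - t)" by auto
    hence "(3/4::real) ^ (k - t) \<le> (3/4) ^ (k - t) * (of_bool (k dvd n + (k - t)) + of_bool (k dvd n - (k - t)))" by auto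
    also have "\<dots> \<le> S" unfolding S_def
      by (rule member_le_sum[OF lt]) auto
    finally show ?thesis by simp
  qed
  ultimately show ?thesis unfolding S_def by linarith
qed

lemma sum_dvd_le_divisor_count:
  assumes "m > 0" shows "(\<Sum>k=1..n. of_bool (k dvd m)) \<le> real (divisor_count m)"
proof -
  have "(\<Sum>k=1..n. of_bool (k dvd m)) = real (card {k \<in> {1..n}. k dvd m})"
    by (simp add: of_bool_def sum.If_cases Int_def)
  also have "\<dots> \<le> real (card {k. k dvd m})"
    using assms by (intro of_nat_mono card_mono) auto
  finally show ?thesis by (simp add: divisor_count_def)
qed

text \<open>
  Summing the error over \<open>k\<close> counts the divisors of each \<open>n \<plusminus> e\<close> with weight \<open>(3/4) ^ e\<close>;
  the constant is \<open>2 \<cdot> 4 \<cdot> 2 + 1\<close>, with 4 bounding the geometric series.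
\<close>

lemma fib_frac_sum_approx:
  assumes "n > 0" "\<And>m. m > 0 \<Longrightarrow> real (divisor_count m) \<le> C * real m powr \<epsilon>" "\<epsilon> > 0" "C \<ge> 0"
  shows "\<bar>fib_frac_sum n - (\<Sum>k=1..n. of_bool (fib_neg n k))\<bar> \<le> 17 * C * (2 * real n) powr \<epsilon>"
proof -
  define B where "B = C * (2 * real n) powr \<epsilon>"
  have B: "real (divisor_count m) \<le> B" if "m > 0" "m \<le> 2 * n" for m
  proof -
    have "real m powr \<epsilon> \<le> (2 * real n) powr \<epsilon>" using that assms(3) by (intro powr_mono2) auto
    hence "C * real m powr \<epsilon> \<le> B" using assms(4) by (simp add: B_def mult_left_mono)
    thus ?thesis using assms(2)[of m] that by linarith
  qed
  have B0: "B \<ge> 0" using assms by (simp add: B_def)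
  have "\<bar>fib_frac_sum n - (\<Sum>k=1..n. of_bool (fib_neg n k))\<bar> \<le>
     (\<Sum>k=1..n. \<bar>frac (real (fib n) / real (fib k)) - of_bool (fib_neg n k)\<bar>)"
    unfolding fib_frac_sum_def sum_subtractf [symmetric] by (rule sum_abs)
  also have "\<dots> \<le> (\<Sum>k=1..n. 2 * (\<Sum>e<n. (3/4) ^ e * (of_bool (k dvd n + e) + of_bool (k dvd n - e))) + of_bool (k dvd n))"
    by (intro sum_mono fib_term_error)
  also have "\<dots> = 2 * (\<Sum>e<n. (3/4) ^ e * ((\<Sum>k=1..n. of_bool (k dvd n + e)) + (\<Sum>k=1..n. of_bool (k dvd n - e)))) 
                 + (\<Sum>k=1..n. of_bool (k dvd n))"
    unfolding sum.distrib sum_distrib_left [symmetric] 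
    by (subst sum.swap) (simp add: sum.distrib sum_distrib_left algebra_simps)
  also have "\<dots> \<le> 2 * (\<Sum>e<n. (3/4) ^ e * (B + B)) + B"
  proof (intro add_mono mult_left_mono sum_mono)
    fix e assume "e \<in> {..<n}"
    hence "n + e \<le> 2 * n" "n - e \<le> 2 * n" "n + e > 0" "n - e > 0" by auto
    thus "(\<Sum>k=1..n. of_bool (k dvd n + e)) \<le> B" "(\<Sum>k=1..n. of_bool (k dvd n - e)) \<le> B"
      using sum_dvd_le_divisor_count[of "n + e" n] sum_dvd_le_divisor_count[of "n - e" n] 
        B[of "n + e"] B[of "n - e"] by linarith+
  next
    show "(\<Sum>k=1..n. of_bool (k dvd n)) \<le> B"
      using sum_dvd_le_divisor_count[of n n] B[of n] assms(1) by auto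
  qed auto
  also have "(\<Sum>e<n. (3/4) ^ e * (B + B)) = (\<Sum>e<n. (3/4::real) ^ e) * (2 * B)"
    by (simp add: sum_distrib_right)
  also have "(\<Sum>e<n. (3/4::real) ^ e) \<le> 4"
    by (subst sum_gp_strict) (auto simp: field_simps)
  hence "2 * ((\<Sum>e<n. (3/4::real) ^ e) * (2 * B)) + B \<le> 2 * (4 * (2 * B)) + B"
    using B0 by (intro add_mono mult_left_mono mult_right_mono) auto
  also have "\<dots> = 17 * C * (2 * real n) powr \<epsilon>" by (simp add: B_def)
  finally show ?thesis by simp
qed

section \<open>Counting negative signs\<close>

text \<open>
  The main term: each negative sign contributes a fractional part close to 1.
\<close>

definition neg_count :: "nat \<Rightarrow> real" where
  "neg_count n = (\<Sum>k=1..n. of_bool (fib_neg n k))"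

lemma fib_frac_sum_minus_neg_count:
  assumes "\<epsilon> > 0"
  obtains K where "K \<ge> 0" "\<And>n. n \<ge> 1 \<Longrightarrow> \<bar>fib_frac_sum n - neg_count n\<bar> \<le> K * real n powr \<epsilon>"
proof -
  obtain C where C: "C \<ge> 0" "\<And>n. n > 0 \<Longrightarrow> real (divisor_count n) \<le> C * real n powr \<epsilon>"
    using divisor_count_bound[OF assms] by blast
  show ?thesis
  proof (rule that[of "17 * C * 2 powr \<epsilon>"])
    fix n :: nat assume "n \<ge> 1"
    thus "\<bar>fib_frac_sum n - neg_count n\<bar> \<le> 17 * C * 2 powr \<epsilon> * real n powr \<epsilon>"
      using fib_frac_sum_approx[of n C \<epsilon>] C assms by (simp add: neg_count_def powr_mult)
  qed (use C in auto)
qed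

lemma mod_4_iff:
  fixes q :: nat
  shows "q mod 4 = 1 \<longleftrightarrow> odd q \<and> even (q div 2)" "q mod 4 = 2 \<longleftrightarrow> even q \<and> odd (q div 2)"
  by presburger+

text \<open>
  For odd \<open>n\<close>, the equation \<open>n = q k + r\<close> fixes the parity of \<open>r\<close>, and the sign depends only on
  \<open>k\<close> modulo 2 and \<open>q\<close> modulo 4. The outcome, \<open>q\<close> congruent to 1 or 2, is where the partial sums of the
  character enter.
\<close>

lemma fib_neg_odd:
  assumes "odd n"
  shows "of_bool (fib_neg n k) = (if odd k then chi4_partial (n div k) else 0)"
proof -
  have "odd (n div k * k + n mod k)" using assms by simp
  hence "even (n mod k) \<longleftrightarrow> odd (n div k) \<and> odd k" unfolding even_add even_mult_iff by blast
  thus ?thesis unfolding chi4_partial_def fib_neg_def Let_def mod_4_iff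
    by auto
qed

lemma fib_neg_even:
  assumes "even n"
  shows "of_bool (fib_neg n k) = (if odd k then real ((n div k) div 2 mod 2) else real (n div k mod 2))"
proof -
  have "even (n div k * k + n mod k)" using assms by simp
  hence "even (n mod k) \<longleftrightarrow> even (n div k) \<or> even k" unfolding even_add even_mult_iff by blast
  thus ?thesis unfolding fib_neg_def Let_def mod2_eq_if
    by auto
qed

lemma neg_count_odd:
  assumes "odd n"
  shows "neg_count n = floor_sum chi4_partial n - floor_sum chi4_partial (n div 2)"
proof -
  have "neg_count n = (\<Sum>k | k \<in> {1..n} \<and> odd k. chi4_partial (n div k))"
    unfolding neg_count_def fib_neg_odd[OF assms] by (subst sum.inter_filter) auto
  thus ?thesis by (subst (asm) floor_sum_odd) (auto simp: chi4_partial_def)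
qed

lemma neg_count_even:
  assumes "even n"
  shows "neg_count n = 2 * floor_sum real (n div 2) - 5 * floor_sum real (n div 2 div 2)
                        + 2 * floor_sum real (n div 2 div 4)"
proof -
  define p where "p = (\<lambda>q. real (q mod 2))"
  have "neg_count n = (\<Sum>k=1..n. (if odd k then p (n div k div 2) else 0)) + (\<Sum>k=1..n. (if even k then p (n div k) else 0))"
    unfolding neg_count_def fib_neg_even[OF assms] p_def sum.distrib [symmetric]
    by (intro sum.cong) auto
  also have "(\<Sum>k=1..n. (if odd k then p (n div k div 2) else 0)) = 
             (\<Sum>k | k \<in> {1..n} \<and> odd k. p (n div k div 2))" by (subst sum.inter_filter) auto
  also have "\<dots> = floor_sum p (n div 2) - floor_sum p (n div 2 div 2)"
  proof -
    have "floor_sum (\<lambda>q. p (q div 2)) i = floor_sum p (i div 2)" for i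
      by (rule floor_sum_half) (simp add: p_def)
    thus ?thesis using floor_sum_odd[of "\<lambda>q. p (q div 2)" n] by (simp add: p_def)
  qed
  also have "(\<Sum>k=1..n. (if even k then p (n div k) else 0)) = 
             (\<Sum>k | k \<in> {1..n} \<and> even k. p (n div k))" by (subst sum.inter_filter) auto
  also have "\<dots> = floor_sum p (n div 2)"
    by (rule floor_sum_even) (simp add: p_def)
  finally show ?thesis
    unfolding p_def floor_sum_parity by (simp add: div_mult2_eq[symmetric])
qed

text \<open>
  Only products of odd numbers contribute to the difference, so it is constant between
  consecutive odd arguments. This is why odd \<open>n\<close> suffice to control it at all real arguments.
\<close>

lemma floor_sum_chi4_odd_steps:
  assumes "odd n"
  shows "floor_sum chi4_partial (Suc n) - floor_sum chi4_partial (Suc n div 2) = 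
         floor_sum chi4_partial n - floor_sum chi4_partial (n div 2)"
proof -
  have "chi4_partial (Suc n div k) = chi4_partial (n div k)" if "odd k" for k
  proof (cases "Suc n mod k = 0")
    case True
    hence "Suc n div k * k = Suc n" by auto
    hence "even (Suc n div k)" using assms that by (metis even_Suc even_mult_iff)
    moreover have "Suc n div k = Suc (n div k)" using True by (simp add: div_Suc)
    ultimately have "odd (n div k)" by simp
    moreover have "q mod 4 = 1 \<or> q mod 4 = 3" if "odd q" for q :: nat using that by presburger
    ultimately have "n div k mod 4 = 1 \<or> n div k mod 4 = 3" by blast
    thus ?thesis unfolding \<open>Suc n div k = Suc (n div k)\<close> by (auto simp: chi4_partial_def mod_Suc)
  qed (simp add: div_Suc)
  hence "(\<Sum>k | k \<in> {1..Suc n} \<and> odd k. chi4_partial (Suc n div k)) = 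
         (\<Sum>k | k \<in> {1..n} \<and> odd k. chi4_partial (n div k))"
    using assms by (intro sum.cong) (auto simp: le_Suc_eq)
  thus ?thesis by (subst (asm) (1 2) floor_sum_odd) (auto simp: chi4_partial_def)
qed


section \<open>The equivalence of the error bounds\<close>

lemma nat_floor_half: "nat \<lfloor>(x::real) / 2\<rfloor> = nat \<lfloor>x\<rfloor> div 2"
  using floor_divide_real_eq_div[of 2 x] by (simp add: nat_div_distrib')

lemma nat_floor_quarter: "nat \<lfloor>(x::real) / 4\<rfloor> = nat \<lfloor>x\<rfloor> div 4"
  using floor_divide_real_eq_div[of 4 x] by (simp add: nat_div_distrib')

lemma Delta_C_difference:
  assumes "x \<ge> 0"
  shows "Delta_C x - Delta_C (x / 2) = 
    4 * (floor_sum chi4_partial (nat \<lfloor>x\<rfloor>) - floor_sum chi4_partial (nat \<lfloor>x\<rfloor> div 2)) - pi / 2 * x"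
  using assms by (simp add: Delta_C_def N_C_eq_floor_sum nat_floor_half algebra_simps)

text \<open>
  The terms \<open>x ln x\<close> and \<open>(2 \<gamma> - 1) x\<close> cancel, since \<open>2 - 5/2 + 2/4 = 0\<close>; the shifts of the
  logarithm leave \<open>(5/2 - 1) ln 2\<close> times \<open>x\<close>.
\<close>

lemma Delta_H_combination:
  assumes "x > 0"
  shows "2 * Delta_H x - 5 * Delta_H (x / 2) + 2 * Delta_H (x / 4) =
    neg_count (2 * nat \<lfloor>x\<rfloor>) - 3 / 2 * ln 2 * x"
proof -
  have "ln 4 = 2 * ln (2::real)" using ln_realpow[of 2 2] by simp
  thus ?thesis using assms 
    by (simp add: Delta_H_def N_H_eq_floor_sum nat_floor_half nat_floor_quarter neg_count_even
        ln_div algebra_simps)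
qed

lemma Delta_C_bounded:
  assumes "0 < x" "x < 1" shows "\<bar>Delta_C x\<bar> \<le> 4"
proof -
  have "\<lfloor>x\<rfloor> = 0" using assms by (simp add: floor_eq_iff)
  hence "Delta_C x = 1 - pi * x" using assms by (simp add: Delta_C_def N_C_eq_floor_sum floor_sum_def)
  moreover have "pi * x \<le> 4 * 1" using assms pi_less_4 by (intro mult_mono) auto
  moreover have "0 \<le> pi * x" using assms by simp
  ultimately show ?thesis by simp
qed

lemma Delta_H_bounded:
  assumes "0 < x" "x < 1" shows "\<bar>Delta_H x\<bar> \<le> 1 + \<bar>2 * euler_mascheroni - 1\<bar>"
proof -
  have "\<lfloor>x\<rfloor> = 0" using assms by (simp add: floor_eq_iff)
  hence "Delta_H x = - (x * ln x) - (2 * euler_mascheroni - 1) * x" 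
    by (simp add: Delta_H_def N_H_eq_floor_sum floor_sum_def)
  moreover have "\<bar>x * ln x\<bar> \<le> 1"
  proof -
    have "- ln x \<le> 1 / x - 1" using ln_le_minus_one[of "1 / x"] assms by (simp add: ln_div)
    hence "x * (- ln x) \<le> x * (1 / x - 1)" using assms by (intro mult_left_mono) auto
    also have "\<dots> \<le> 1" using assms by (simp add: algebra_simps)
    finally show ?thesis using assms by (simp add: abs_mult)
  qed
  moreover have "\<bar>(2 * euler_mascheroni - 1) * x\<bar> \<le> \<bar>2 * euler_mascheroni - 1\<bar>"
    using assms by (simp add: abs_mult mult_left_le)
  ultimately show ?thesis by linarith
qed

lemma extend_bound:
  fixes D :: "real \<Rightarrow> real"
  assumes "\<And>x. x \<ge> 1 \<Longrightarrow> \<bar>D x\<bar> \<le> K * x powr s" "\<And>x. 0 < x \<Longrightarrow> x < 1 \<Longrightarrow> \<bar>D x\<bar> \<le> B"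
    and "s \<ge> 0" "0 < x" "x \<le> y" "y \<ge> 1"
  shows "\<bar>D x\<bar> \<le> (\<bar>K\<bar> + B) * y powr s"
proof -
  have B0: "B \<ge> 0" using assms(2)[of "1/2"] by auto
  have y: "1 \<le> y powr s" using assms by (intro ge_one_powr_ge_zero) auto
  have "\<bar>D x\<bar> \<le> \<bar>K\<bar> * y powr s \<or> \<bar>D x\<bar> \<le> B * y powr s"
  proof (cases "x < 1")
    case True
    have "B * 1 \<le> B * y powr s" using y B0 by (intro mult_left_mono)
    thus ?thesis using assms(2)[of x] assms(4) True by linarith
  next
    case False
    have "K * x powr s \<le> \<bar>K\<bar> * y powr s" using assms by (intro mult_mono powr_mono2) auto
    thus ?thesis using assms(1)[of x] False by linarith
  qed
  moreover have "0 \<le> B * y powr s" "0 \<le> \<bar>K\<bar> * y powr s" using B0 by simp_all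
  ultimately show ?thesis unfolding distrib_right by linarith
qed

lemma abs_le_quarter:
  fixes a b c e :: real
  assumes "4 * e = 4 * a + (b - c)" "\<bar>a\<bar> \<le> A" "\<bar>b\<bar> \<le> C" "\<bar>c\<bar> \<le> C"
  shows "\<bar>e\<bar> \<le> A + C"
proof -
  have "- A \<le> a" "a \<le> A" "- C \<le> b" "b \<le> C" "- C \<le> c" "c \<le> C"
    using assms(2-4) by (simp_all only: abs_le_iff minus_le_iff)
  thus ?thesis using assms(1) by (intro abs_leI) linarith+
qed
lemma abs_le_weighted:
  fixes a e u :: real
  assumes "d = 4 * (- a) + 4 * e - u" "\<bar>a\<bar> \<le> A" "\<bar>e\<bar> \<le> B" "\<bar>u\<bar> \<le> C"
  shows "\<bar>d\<bar> \<le> 4 * A + 4 * B + C"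
proof -
  have "- A \<le> a" "a \<le> A" "- B \<le> e" "e \<le> B" "- C \<le> u" "u \<le> C"
    using assms(2-4) by (simp_all only: abs_le_iff minus_le_iff)
  thus ?thesis using assms(1) by (intro abs_leI) linarith+
qed

lemma fib_frac_sum_bound_from_circle:
  assumes "0 \<le> \<theta>" "\<epsilon> > 0" and K: "\<And>x. x \<ge> 1 \<Longrightarrow> \<bar>Delta_C x\<bar> \<le> K * x powr (\<theta> + \<epsilon>)"
  shows "\<exists>K. \<forall>n\<ge>1. odd n \<longrightarrow> \<bar>fib_frac_sum n - pi / 8 * real n\<bar> \<le> K * real n powr (\<theta> + \<epsilon>)"
proof -
  define s where "s = \<theta> + \<epsilon>"
  define M where "M = \<bar>K\<bar>"
  have M: "K \<le> M" "0 \<le> M" by (auto simp: M_def)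
  obtain K1 where K1: "K1 \<ge> 0" "\<And>n. n \<ge> 1 \<Longrightarrow> \<bar>fib_frac_sum n - neg_count n\<bar> \<le> K1 * real n powr \<epsilon>"
    using fib_frac_sum_minus_neg_count[OF assms(2)] by blast
  have D: "\<bar>Delta_C x\<bar> \<le> (M + 4) * y powr s" if "0 < x" "x \<le> y" "y \<ge> 1" for x y
    unfolding M_def using assms that by (intro extend_bound K Delta_C_bounded) (auto simp: s_def)
  show ?thesis
  proof (intro exI allI impI)
    fix n :: nat assume n: "n \<ge> 1" "odd n"
    define e where "e = fib_frac_sum n - pi / 8 * real n"
    have "4 * e = 4 * (fib_frac_sum n - neg_count n) + (Delta_C n - Delta_C (n / 2))"
      using Delta_C_difference[of n] n by (simp add: e_def neg_count_odd field_simps)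
    moreover have "\<bar>fib_frac_sum n - neg_count n\<bar> \<le> K1 * real n powr s"
    proof -
      have "K1 * real n powr \<epsilon> \<le> K1 * real n powr s"
        using n K1 assms by (intro mult_left_mono powr_mono) (auto simp: s_def)
      thus ?thesis using K1(2)[OF n(1)] by (rule order_trans[rotated])
    qed
    moreover have "\<bar>Delta_C n\<bar> \<le> (M + 4) * real n powr s" "\<bar>Delta_C (n / 2)\<bar> \<le> (M + 4) * real n powr s"
      using n by (intro D; simp)+
    ultimately have "\<bar>e\<bar> \<le> K1 * real n powr s + (M + 4) * real n powr s"
      by (rule abs_le_quarter)
    thus "\<bar>fib_frac_sum n - pi / 8 * real n\<bar> \<le> (K1 + (M + 4)) * real n powr (\<theta> + \<epsilon>)"
      by (simp add: e_def s_def distrib_right)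
  qed
qed

lemma circle_bound_from_fib_frac_sum:
  assumes "0 \<le> \<theta>" "\<epsilon> > 0" 
    and K: "\<And>n. n \<ge> 1 \<Longrightarrow> odd n \<Longrightarrow> \<bar>fib_frac_sum n - pi / 8 * real n\<bar> \<le> K * real n powr (\<theta> + \<epsilon>)"
  shows "\<exists>K. \<forall>x\<ge>1. \<bar>Delta_C x\<bar> \<le> K * x powr (\<theta> + \<epsilon>)"
proof -
  define s where "s = \<theta> + \<epsilon>"
  define M where "M = \<bar>K\<bar>"
  have M: "K \<le> M" "0 \<le> M" by (auto simp: M_def)
  have s: "s > 0" "\<epsilon> \<le> s" using assms by (auto simp: s_def)
  obtain K1 where K1: "K1 \<ge> 0" "\<And>n. n \<ge> 1 \<Longrightarrow> \<bar>fib_frac_sum n - neg_count n\<bar> \<le> K1 * real n powr \<epsilon>"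
    using fib_frac_sum_minus_neg_count[OF assms(2)] by blast
  have "\<bar>Delta_C x - Delta_C (x / 2)\<bar> \<le> (4 * K1 + 4 * M + 4) * x powr s" if x: "x \<ge> 1" for x
  proof -
    define n where "n = nat \<lfloor>x\<rfloor>"
    have n: "n \<ge> 1" "real n \<le> x" "x < real n + 1" using x by (auto simp: n_def le_nat_iff)
    define m where "m = (if odd n then n else n - 1)"
    have m: "odd m" "m \<ge> 1" "m = n \<or> Suc m = n" using n(1) by (auto simp: m_def elim!: evenE)
    have mx: "real m \<le> x" "x \<le> real m + 2" using m n by auto
    have diff: "Delta_C x - Delta_C (x / 2) = 4 * neg_count m - pi / 2 * x"
      using Delta_C_difference[of x] x floor_sum_chi4_odd_steps[OF m(1)] m(3)
      unfolding neg_count_odd[OF m(1)] n_def[symmetric] by auto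
    define e where "e = fib_frac_sum m - pi / 8 * real m"
    define u where "u = pi / 2 * (x - real m)"
    have "Delta_C x - Delta_C (x / 2) = 4 * (- (fib_frac_sum m - neg_count m)) + 4 * e - u"
      unfolding diff by (simp add: e_def u_def field_simps)
    moreover have "\<bar>fib_frac_sum m - neg_count m\<bar> \<le> K1 * x powr s"
    proof -
      have "real m powr \<epsilon> \<le> x powr s"
        using mx m x s assms(2) powr_mono2[of \<epsilon> "real m" x] powr_mono[of \<epsilon> s x] by linarith
      hence "K1 * real m powr \<epsilon> \<le> K1 * x powr s" using K1 by (intro mult_left_mono)
      thus ?thesis using K1(2)[OF m(2)] by (rule order_trans[rotated])
    qed
    moreover have "\<bar>e\<bar> \<le> M * x powr s"
    proof -
      have "K * real m powr s \<le> M * x powr s"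
        using mx s M by (intro mult_mono powr_mono2) auto
      moreover have "\<bar>e\<bar> \<le> K * real m powr s" using K m by (simp add: e_def s_def)
      ultimately show ?thesis by (rule order_trans[rotated])
    qed
    moreover have "\<bar>pi / 2\<bar> * \<bar>x - real m\<bar> \<le> 2 * 2" 
      using mx pi_less_4 by (intro mult_mono) auto
    hence "\<bar>u\<bar> \<le> 4" unfolding u_def abs_mult by simp
    ultimately have "\<bar>Delta_C x - Delta_C (x / 2)\<bar> \<le> 4 * (K1 * x powr s) + 4 * (M * x powr s) + 4"
      by (rule abs_le_weighted)
    moreover have "1 \<le> x powr s" using x s by (intro ge_one_powr_ge_zero) auto
    ultimately have "\<bar>Delta_C x - Delta_C (x / 2)\<bar> \<le> 4 * (K1 * x powr s) + 4 * (M * x powr s) + 4 * x powr s"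
      by linarith
    thus ?thesis by (simp add: algebra_simps)
  qed
  then obtain C where "\<And>x. x \<ge> 1 \<Longrightarrow> \<bar>Delta_C x\<bar> \<le> C * x powr s"
    using bound_from_halving_difference[of s "4 * K1 + 4 * M + 4" Delta_C 4] s(1) K1(1) M(2) Delta_C_bounded by auto
  thus ?thesis unfolding s_def by blast
qed

lemma fib_frac_sum_bound_from_hyperbola:
  assumes "0 \<le> \<theta>" "\<epsilon> > 0" and K: "\<And>x. x \<ge> 1 \<Longrightarrow> \<bar>Delta_H x\<bar> \<le> K * x powr (\<theta> + \<epsilon>)"
  shows "\<exists>K. \<forall>n\<ge>1. even n \<longrightarrow> \<bar>fib_frac_sum n - 3 * ln 2 / 4 * real n\<bar> \<le> K * real n powr (\<theta> + \<epsilon>)"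
proof -
  define s where "s = \<theta> + \<epsilon>"
  define M where "M = \<bar>K\<bar>"
  have M: "K \<le> M" "0 \<le> M" by (auto simp: M_def)
  define B where "B = 1 + \<bar>2 * euler_mascheroni - 1 :: real\<bar>"
  obtain K1 where K1: "K1 \<ge> 0" "\<And>n. n \<ge> 1 \<Longrightarrow> \<bar>fib_frac_sum n - neg_count n\<bar> \<le> K1 * real n powr \<epsilon>"
    using fib_frac_sum_minus_neg_count[OF assms(2)] by blast
  have D: "\<bar>Delta_H x\<bar> \<le> (M + B) * y powr s" if "0 < x" "x \<le> y" "y \<ge> 1" for x y
    unfolding B_def M_def using assms that by (intro extend_bound K Delta_H_bounded) (auto simp: s_def)
  show ?thesis
  proof (intro exI allI impI)
    fix n :: nat assume n: "n \<ge> 1" "even n"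
    then obtain y where y: "n = 2 * y" "y \<ge> 1" by (auto elim!: evenE)
    have "fib_frac_sum n - 3 * ln 2 / 4 * real n = (fib_frac_sum n - neg_count n) + 
            (2 * Delta_H y - 5 * Delta_H (y / 2) + 2 * Delta_H (y / 4))"
      using Delta_H_combination[of y] y by simp
    moreover have "K1 * real n powr \<epsilon> \<le> K1 * real n powr s"
      using n K1 assms by (intro mult_left_mono powr_mono) (auto simp: s_def)
    moreover have "\<bar>fib_frac_sum n - neg_count n\<bar> \<le> K1 * real n powr \<epsilon>" using K1 n by blast
    moreover have "\<bar>Delta_H y\<bar> \<le> (M + B) * real n powr s" "\<bar>Delta_H (y / 2)\<bar> \<le> (M + B) * real n powr s"
       "\<bar>Delta_H (y / 4)\<bar> \<le> (M + B) * real n powr s"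
      using y by (intro D; simp)+
    ultimately have "\<bar>fib_frac_sum n - 3 * ln 2 / 4 * real n\<bar> \<le> 
        K1 * real n powr s + 9 * ((M + B) * real n powr s)"
      by linarith
    thus "\<bar>fib_frac_sum n - 3 * ln 2 / 4 * real n\<bar> \<le> (K1 + 9 * (M + B)) * real n powr (\<theta> + \<epsilon>)"
      by (simp add: s_def algebra_simps)
  qed
qed

text \<open>
  The restriction \<open>\<theta> + \<epsilon> < 1\<close> keeps the exponent in the range where the upward
  iteration converges; larger \<open>\<epsilon>\<close> follow by monotonicity.
\<close>

lemma hyperbola_bound_from_fib_frac_sum:
  assumes "0 \<le> \<theta>" "\<epsilon> > 0" "\<theta> + \<epsilon> < 1"
    and K: "\<And>n. n \<ge> 1 \<Longrightarrow> even n \<Longrightarrow> \<bar>fib_frac_sum n - 3 * ln 2 / 4 * real n\<bar> \<le> K * real n powr (\<theta> + \<epsilon>)"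
  shows "\<exists>K. \<forall>x\<ge>1. \<bar>Delta_H x\<bar> \<le> K * x powr (\<theta> + \<epsilon>)"
proof -
  define s where "s = \<theta> + \<epsilon>"
  define M where "M = \<bar>K\<bar>"
  have M: "K \<le> M" "0 \<le> M" by (auto simp: M_def)
  have s: "s > 0" "\<epsilon> \<le> s" "s < 1" using assms by (auto simp: s_def)
  obtain K1 where K1: "K1 \<ge> 0" "\<And>n. n \<ge> 1 \<Longrightarrow> \<bar>fib_frac_sum n - neg_count n\<bar> \<le> K1 * real n powr \<epsilon>"
    using fib_frac_sum_minus_neg_count[OF assms(2)] by blast
  define L where "L = (K1 + M) * 2 powr s + 2"
  have "\<bar>2 * Delta_H x - 5 * Delta_H (x / 2) + 2 * Delta_H (x / 4)\<bar> \<le> L * x powr s" if x: "x \<ge> 1" for x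
  proof -
    define n where "n = 2 * nat \<lfloor>x\<rfloor>"
    define u where "u = 3 / 4 * ln 2 * (2 * x - real n)"
    have "nat \<lfloor>x\<rfloor> \<ge> 1" "real (nat \<lfloor>x\<rfloor>) \<le> x" "x < real (nat \<lfloor>x\<rfloor>) + 1"
      using x by (auto simp: le_nat_iff)
    hence nx: "real n \<le> 2 * x" "2 * x \<le> real n + 2" "n \<ge> 1" "even n"
      unfolding n_def of_nat_mult of_nat_numeral by (linarith+) simp
    have "2 * Delta_H x - 5 * Delta_H (x / 2) + 2 * Delta_H (x / 4) = 
            (neg_count n - fib_frac_sum n) + (fib_frac_sum n - 3 * ln 2 / 4 * real n) - u"
      using Delta_H_combination[of x] x unfolding n_def[symmetric] u_def by (simp add: field_simps)
    moreover have "\<bar>fib_frac_sum n - neg_count n\<bar> \<le> K1 * real n powr \<epsilon>" using K1 nx by blast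
    moreover have "real n powr \<epsilon> \<le> (2 * x) powr s"
      using nx x s assms(2) powr_mono2[of \<epsilon> "real n" "2 * x"] powr_mono[of \<epsilon> s "2 * x"] by linarith
    hence "K1 * real n powr \<epsilon> \<le> K1 * (2 * x) powr s" using K1 by (intro mult_left_mono)
    moreover have "\<bar>fib_frac_sum n - 3 * ln 2 / 4 * real n\<bar> \<le> K * real n powr s" using K nx by (simp add: s_def)
    moreover have "K * real n powr s \<le> M * (2 * x) powr s"
      using nx s M by (intro mult_mono powr_mono2) auto
    moreover have "\<bar>u\<bar> \<le> 3 / 4 * 1 * 2" 
      unfolding u_def abs_mult using nx ln_2_less_1 by (intro mult_mono) auto
    moreover have "1 \<le> x powr s" using x s by (intro ge_one_powr_ge_zero) auto
    ultimately have "\<bar>2 * Delta_H x - 5 * Delta_H (x / 2) + 2 * Delta_H (x / 4)\<bar> \<le> 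
        K1 * (2 * x) powr s + M * (2 * x) powr s + 2 * x powr s"
      by linarith
    also have "\<dots> = L * x powr s" using x by (simp add: L_def powr_mult algebra_simps)
    finally show ?thesis .
  qed
  then obtain C where "\<And>x. x \<ge> 1 \<Longrightarrow> \<bar>Delta_H x\<bar> \<le> C * x powr s"
    using bound_from_second_order_recurrence[OF s(1,3) _ Delta_H_bounded Delta_H_over_x_tendsto_0] by blast
  thus ?thesis unfolding s_def by blast
qed

theorem mainTheorem2:
  fixes \<theta>\<^sub>C \<theta>\<^sub>H :: real
  assumes "0 \<le> \<theta>\<^sub>C" and "\<theta>\<^sub>C < 1" and "0 \<le> \<theta>\<^sub>H" and "\<theta>\<^sub>H < 1"
  shows
    "(\<forall>\<epsilon>>0.
        (\<exists>K. \<forall>x\<ge>1. \<bar>Delta_C x\<bar> \<le> K * x powr (\<theta>\<^sub>C + \<epsilon>)) \<and>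
        (\<exists>K. \<forall>x\<ge>1. \<bar>Delta_H x\<bar> \<le> K * x powr (\<theta>\<^sub>H + \<epsilon>)))
     \<longleftrightarrow>
     (\<forall>\<epsilon>>0.
        (\<exists>K. \<forall>n\<ge>1. odd n \<longrightarrow>
           \<bar>fib_frac_sum n - pi / 8 * real n\<bar> \<le> K * real n powr (\<theta>\<^sub>C + \<epsilon>)) \<and>
        (\<exists>K. \<forall>n\<ge>1. even n \<longrightarrow>
           \<bar>fib_frac_sum n - 3 * ln 2 / 4 * real n\<bar> \<le> K * real n powr (\<theta>\<^sub>H + \<epsilon>)))"
    (is "?lattice \<longleftrightarrow> ?fib")
proof
  assume lattice: ?lattice
  show ?fib
  proof (intro allI impI conjI)
    fix \<epsilon> :: real assume \<epsilon>: "\<epsilon> > 0"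
    show "\<exists>K. \<forall>n\<ge>1. odd n \<longrightarrow> \<bar>fib_frac_sum n - pi / 8 * real n\<bar> \<le> K * real n powr (\<theta>\<^sub>C + \<epsilon>)"
      using lattice \<epsilon> fib_frac_sum_bound_from_circle[OF assms(1) \<epsilon>] by blast
    show "\<exists>K. \<forall>n\<ge>1. even n \<longrightarrow> \<bar>fib_frac_sum n - 3 * ln 2 / 4 * real n\<bar> \<le> K * real n powr (\<theta>\<^sub>H + \<epsilon>)"
      using lattice \<epsilon> fib_frac_sum_bound_from_hyperbola[OF assms(3) \<epsilon>] by blast
  qed
next
  assume fib: ?fib
  show ?lattice
  proof (intro allI impI conjI)
    fix \<epsilon> :: real assume \<epsilon>: "\<epsilon> > 0"
    show "\<exists>K. \<forall>x\<ge>1. \<bar>Delta_C x\<bar> \<le> K * x powr (\<theta>\<^sub>C + \<epsilon>)"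
      using fib \<epsilon> circle_bound_from_fib_frac_sum[OF assms(1) \<epsilon>] by blast
    define \<delta> where "\<delta> = min \<epsilon> ((1 - \<theta>\<^sub>H) / 2)"
    have \<delta>: "\<delta> > 0" "\<delta> \<le> \<epsilon>" "\<theta>\<^sub>H + \<delta> < 1" using \<epsilon> assms by (auto simp: \<delta>_def min_def field_simps)
    then obtain K where K: "\<forall>x\<ge>1. \<bar>Delta_H x\<bar> \<le> K * x powr (\<theta>\<^sub>H + \<delta>)"
      using fib hyperbola_bound_from_fib_frac_sum[OF assms(3) \<delta>(1,3)] by blast
    have "\<bar>Delta_H x\<bar> \<le> \<bar>K\<bar> * x powr (\<theta>\<^sub>H + \<epsilon>)" if "x \<ge> 1" for x
    proof -
      have "\<bar>Delta_H x\<bar> \<le> K * x powr (\<theta>\<^sub>H + \<delta>)" using K that by blast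
      also have "\<dots> \<le> \<bar>K\<bar> * x powr (\<theta>\<^sub>H + \<epsilon>)"
        using that \<delta> by (intro mult_mono powr_mono) auto
      finally show ?thesis .
    qed
    thus "\<exists>K. \<forall>x\<ge>1. \<bar>Delta_H x\<bar> \<le> K * x powr (\<theta>\<^sub>H + \<epsilon>)" by blast
  qed
qed

end
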